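(* Let $n\ge 1$, let $\sigma_1,\sigma_2>0$, and let $\eta:\mathbb{R}^n\to\mathbb{R}$ be a continuous function, positive on $\mathbb{R}^n\setminus\{0\}$, such that $$\eta(\xi)\sim |\xi|^{\sigma_1}\ \text{ as } |\xi|\to 0,\qquad \eta(\xi)\sim|\xi|^{-\sigma_2}\ \text{ as } |\xi|\to\infty .$$ Let $1\le q,r\le 2\le p\le\infty$, and let $j,k,\ell$ be non-negative integers with $0\le j\le k$ and $\ell>n\left(\frac1r-\frac1p\right)$ (in the case $p=r=2$ it is only required that $\ell\ge 0$). Then there is a constant $C>0$ such that for all $\phi\in\mathcal{S}(\mathbb{R}^n)$ and all $t\ge 0$, $$\left\|\mathcal{F}^{-1}\left[|\xi|^{k}e^{-\eta(\xi)t}|\hat\phi(\xi)|\right]\right\|_{L^p}\le C(1+t)^{-\gamma_{\sigma_1}(q,p)-\frac{k-j}{\sigma_1}}\|\partial_x^j\phi\|_{L^q}+C(1+t)^{-\frac{\ell}{\sigma_2}+\gamma_{\sigma_2}(r,p)}\|\partial_x^{k+\ell}\phi\|_{L^r}.$$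
   Context: For $\sigma>0$, $\gamma_\sigma(q,p):=\frac{n}{\sigma}\left(\frac1q-\frac1p\right)$. $\mathcal{S}(\mathbb{R}^n)$ is the Schwartz class, $\hat\phi(\xi)=\mathcal{F}[\phi](\xi)=\int_{\mathbb{R}^n}\phi(x)e^{-2\pi i x\cdot\xi}\,dx$ is the Fourier transform and $\mathcal{F}^{-1}$ its inverse. $\eta\sim g$ in a limit means that $\eta$ is bounded above and below by positive constant multiples of $g$ near that limit. $\|\partial_x^m\phi\|_{L^r}$ denotes the $L^r$ norm of the collection of all partial derivatives of $\phi$ of order $m$. All $L^p$ norms are over $\mathbb{R}^n$. *)

theory Defs
  imports "HOL-Probability.Essential_Supremum"
begin

text \<open>
  Euclidean space \<open>\<real>\<^sup>n\<close> is \<open>real ^ 'n\<close> with \<open>n = CARD('n)\<close>; Lebesgue exponents range over \<^typ>\<open>ennreal\<close>,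
  where \<open>1 / \<infinity> = 0\<close>.
\<close>

definition partial_deriv ::
    "'n::finite \<Rightarrow> (real ^ 'n \<Rightarrow> 'b::real_normed_vector) \<Rightarrow> real ^ 'n \<Rightarrow> 'b" where
  "partial_deriv i f x = vector_derivative (\<lambda>s. f (x + s *\<^sub>R axis i 1)) (at 0)"

text \<open>For a list of directions, the first entry is the derivative taken last.\<close>

definition partial_derivs ::
    "'n::finite list \<Rightarrow> (real ^ 'n \<Rightarrow> 'b::real_normed_vector) \<Rightarrow> real ^ 'n \<Rightarrow> 'b" where
  "partial_derivs is f = foldr partial_deriv is f"

text \<open>
  Total differentiability of all iterated partial derivatives is the same as being of
  class \<open>C\<^sup>\<infinity>\<close>.
\<close>

definition schwartz :: "(real ^ 'n::finite \<Rightarrow> complex) set" where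
  "schwartz =
     {\<phi>. (\<forall>is. partial_derivs is \<phi> differentiable_on UNIV) \<and>
          (\<forall>is m. bounded (range (\<lambda>x. norm x ^ m *\<^sub>R partial_derivs is \<phi> x)))}"

definition fourier :: "(real ^ 'n::finite \<Rightarrow> complex) \<Rightarrow> real ^ 'n \<Rightarrow> complex" where
  "fourier \<phi> \<xi> = (LINT x|lborel. \<phi> x * cis (- (2 * pi * (x \<bullet> \<xi>))))"

definition inv_fourier :: "(real ^ 'n::finite \<Rightarrow> complex) \<Rightarrow> real ^ 'n \<Rightarrow> complex" where
  "inv_fourier g x = (LINT \<xi>|lborel. g \<xi> * cis (2 * pi * (x \<bullet> \<xi>)))"

text \<open>
  The \<open>L\<^sup>p\<close> norm for \<open>1 \<le> p \<le> \<infinity>\<close>. It takes the value \<open>\<infinity>\<close> on measurable functions outside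
  \<open>L\<^sup>p\<close>.
\<close>

definition Lp_norm :: "ennreal \<Rightarrow> ('a::euclidean_space \<Rightarrow> 'b::real_normed_vector) \<Rightarrow> ennreal" where
  "Lp_norm p f =
     (if p = \<infinity> then esssup lborel (\<lambda>x. ennreal (norm (f x)))
      else (let I = \<integral>\<^sup>+ x. ennreal (norm (f x) powr enn2real p) \<partial>lborel
            in if I = \<infinity> then \<infinity> else ennreal (enn2real I powr (1 / enn2real p))))"

text \<open>
  Pointwise Euclidean length of the collection of all partial derivatives of order \<open>m\<close>.
  The collection is indexed by ordered tuples of directions, so a derivative with multi-index
  \<open>\<alpha>\<close> occurs \<open>m! / \<alpha>!\<close> times; this is the Hilbert-Schmidt norm of the \<open>m\<close>-th derivative
  tensor.
\<close>

definition derivs_length :: "nat \<Rightarrow> (real ^ 'n::finite \<Rightarrow> complex) \<Rightarrow> real ^ 'n \<Rightarrow> real" where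
  "derivs_length m \<phi> x = sqrt (\<Sum>is | length is = m. (norm (partial_derivs is \<phi> x))\<^sup>2)"

definition gamma_exponent :: "nat \<Rightarrow> real \<Rightarrow> ennreal \<Rightarrow> ennreal \<Rightarrow> real" where
  "gamma_exponent n \<sigma> q p = real n / \<sigma> * (enn2real (1 / q) - enn2real (1 / p))"

end

theory Submission
  imports Defs "HOL-Probability.Characteristic_Functions" "HOL-Real_Asymp.Real_Asymp"
begin

text \<open>
  The estimate is a frequency-side statement. For \<open>g(\<xi>) = |\<xi>|\<^sup>k e\<^bsup>-\<eta>(\<xi>)t\<^esup> |\<phi>\<^sup>^(\<xi>)|\<close> the
  Hausdorff-Young inequality bounds \<open>\<parallel>F\<^sup>-\<^sup>1 g\<parallel>\<close> in \<open>L\<^sup>p\<close> by \<open>\<parallel>g\<parallel>\<close> in \<open>L\<^bsup>p'\<^esup>\<close> with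
  \<open>1/p + 1/p' = 1\<close>, and \<open>g\<close> is cut at
  \<open>|\<xi>| = 1\<close>. Continuity and positivity of \<open>\<eta>\<close> on compact annuli extend its two asymptotic lower bounds to
  \<open>\<eta> \<ge> c |\<xi>|\<^sup>\<sigma>\<close>, with \<open>\<sigma> = \<sigma>\<^sub>1\<close> on the unit ball and \<open>\<sigma> = -\<sigma>\<^sub>2\<close> outside it
  (\<open>symbol_lower_bounds\<close>). In both regions \<open>|\<xi>|\<^sup>\<sigma> \<le> 1\<close>, so \<open>t\<close> may be replaced by \<open>1 + t\<close> in
  \<open>e\<^bsup>-c|\<xi>|\<^sup>\<sigma>t\<^esup>\<close> at the price of a constant factor, and then everything scales.

  In each region \<open>|\<xi>|\<^sup>k\<close> is written as \<open>|\<xi>|\<^sup>a |\<xi>|\<^sup>m\<close>: with \<open>a = k - j\<close>, \<open>m = j\<close> for low frequencies and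
  \<open>a = -l\<close>, \<open>m = k + l\<close> for high ones. Hoelder's inequality separates the radial multiplier
  \<open>|\<xi>|\<^sup>a e\<^bsup>-c(1+t)|\<xi>|\<^sup>\<sigma>\<^esup>\<close>, measured in \<open>L\<^sup>s\<close> with \<open>1/s = 1/q - 1/p\<close> (respectively \<open>1/r - 1/p\<close>), from
  \<open>|\<xi>|\<^sup>m |\<phi>\<^sup>^|\<close>. Substituting \<open>\<zeta> = (1+t)\<^bsup>1/\<sigma>\<^esup> \<xi>\<close> shows that the multiplier has norm
  \<open>const (1+t)\<^bsup>-a/\<sigma> - n/(\<sigma>s)\<^esup>\<close> (\<open>Lrec_radial_multiplier_time_decay\<close>), which gives both decay rates at
  once; the condition on \<open>l\<close> is exactly what makes the constant finite for \<open>\<sigma> < 0\<close> (if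
  \<open>s = \<infinity>\<close>, boundedness of the multiplier suffices). The other factor is
  bounded by the derivatives of \<open>\<phi>\<close> through a second use of Hausdorff-Young, because
  \<open>(2\<pi>i\<xi>\<^sub>i)\<^sup>m \<phi>\<^sup>^\<close> is the transform of \<open>\<partial>\<^sub>i\<^sup>m \<phi>\<close> and some component satisfies \<open>|\<xi>| \<le> n |\<xi>\<^sub>i|\<close>
  (\<open>hausdorff_young_derivatives\<close>).

  The Hausdorff-Young inequality is needed only up to a constant, so it follows by real interpolation between the
  trivial bound \<open>L\<^sup>1 \<rightarrow> L\<^sup>\<infinity>\<close> and Plancherel's inequality \<open>L\<^sup>2 \<rightarrow> L\<^sup>2\<close>. Plancherel's inequality in turn comes from
  inserting a Gaussian into \<open>\<integral>|f\<^sup>^|\<^sup>2\<close>, which turns it into a quadratic form of \<open>f\<close> with a probability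
  density as kernel.
\<close>

section \<open>Lebesgue norms indexed by the reciprocal exponent\<close>

text \<open>
  All exponent relations in the argument are linear in the reciprocals of the Lebesgue exponents, so norms are
  indexed by the reciprocal \<open>\<theta> = 1/p\<close>. The value \<open>\<theta> = 0\<close> means \<open>p = \<infinity>\<close>, since \<open>inverse 0 = \<infinity>\<close> in
  the extended nonnegative reals.
\<close>

abbreviation Lrec :: "real \<Rightarrow> ('a::euclidean_space \<Rightarrow> 'b::real_normed_vector) \<Rightarrow> ennreal" where
  "Lrec \<theta> f \<equiv> Lp_norm (inverse (ennreal \<theta>)) f"

lemma Lrec_0_le_iff:
  fixes f :: "'a::euclidean_space \<Rightarrow> 'b::real_normed_vector"
  assumes [measurable]: "f \<in> borel_measurable borel" and B: "B \<ge> 0"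
  shows "Lrec 0 f \<le> ennreal B \<longleftrightarrow> (AE x in lborel. norm (f x) \<le> B)"
proof
  assume *: "Lrec 0 f \<le> ennreal B"
  have "AE x in lborel. ennreal (norm (f x)) \<le> esssup lborel (\<lambda>x. ennreal (norm (f x)))"
    by (rule esssup_AE)
  then show "AE x in lborel. norm (f x) \<le> B"
  proof eventually_elim
    case (elim x)
    then have "ennreal (norm (f x)) \<le> ennreal B"
      using * by (auto simp: Lp_norm_def)
    then show ?case using B by simp
  qed
next
  assume "AE x in lborel. norm (f x) \<le> B"
  then show "Lrec 0 f \<le> ennreal B"
    by (auto simp: Lp_norm_def intro!: esssup_I elim!: eventually_mono intro: ennreal_leI)
qed

lemma Lrec_pos_le_iff:
  assumes \<theta>: "\<theta> > 0" and B: "B \<ge> 0"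
  shows "Lrec \<theta> f \<le> ennreal B \<longleftrightarrow>
    (\<integral>\<^sup>+ x. ennreal (norm (f x) powr (1 / \<theta>)) \<partial>lborel) \<le> ennreal (B powr (1 / \<theta>))"
proof -
  have e: "inverse (ennreal \<theta>) = ennreal (1 / \<theta>)"
    using \<theta> by (simp add: inverse_ennreal field_simps)
  define I where "I = (\<integral>\<^sup>+ x. ennreal (norm (f x) powr (1 / \<theta>)) \<partial>lborel)"
  have *: "Lrec \<theta> f = (if I = \<infinity> then \<infinity> else ennreal (enn2real I powr \<theta>))"
    using \<theta> by (simp add: e Lp_norm_def I_def Let_def)
  have "Lrec \<theta> f \<le> ennreal B \<longleftrightarrow> I \<le> ennreal (B powr (1 / \<theta>))"
  proof (cases I)
    case (real i)
    have "i powr \<theta> \<le> B \<longleftrightarrow> i \<le> B powr (1 / \<theta>)"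
    proof
      assume "i powr \<theta> \<le> B"
      then have "(i powr \<theta>) powr (1/\<theta>) \<le> B powr (1 / \<theta>)"
        using \<theta> by (intro powr_mono2) auto
      then show "i \<le> B powr (1 / \<theta>)" using \<theta> real by (simp add: powr_powr)
    next
      assume "i \<le> B powr (1 / \<theta>)"
      then have "i powr \<theta> \<le> (B powr (1 / \<theta>)) powr \<theta>"
        using \<theta> real by (intro powr_mono2) auto
      then show "i powr \<theta> \<le> B" using \<theta> B by (simp add: powr_powr)
    qed
    then show ?thesis using * real B by simp
  qed (use * in \<open>auto simp: top_unique\<close>)
  then show ?thesis by (simp add: I_def)
qed

text \<open>
  Homogeneous inequalities between norms need only be checked against positive finite bounds \<open>B\<close> of the right-hand
  norm. This disposes of the cases of norm \<open>0\<close> and \<open>\<infinity>\<close> once and for all and permits division by \<open>B\<close>.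
\<close>

lemma ennreal_le_cmult_of_scale:
  fixes X Y :: ennreal and C :: real
  assumes C: "C > 0"
    and le: "\<And>B. B > 0 \<Longrightarrow> X \<le> ennreal B \<Longrightarrow> Y \<le> ennreal (C * B)"
  shows "Y \<le> ennreal C * X"
proof (cases X)
  case (real x)
  have "Y \<le> ennreal (C * x)"
  proof (rule ennreal_le_epsilon)
    fix e :: real assume e: "e > 0"
    have "Y \<le> ennreal (C * (x + e / C))"
      using e C real by (intro le) (auto intro!: ennreal_leI add_nonneg_pos)
    also have "C * (x + e / C) = C * x + e" using C by (simp add: field_simps)
    finally show "Y \<le> ennreal (C * x) + ennreal e"
      using e C real by (simp add: ennreal_plus)
  qed
  then show ?thesis using real C by (simp add: ennreal_mult)
qed (use C in \<open>auto simp: ennreal_mult_top\<close>)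

lemma Lrec_mono:
  fixes f :: "'a::euclidean_space \<Rightarrow> 'b::real_normed_vector"
    and g :: "'a \<Rightarrow> 'c::real_normed_vector"
  assumes [measurable]: "f \<in> borel_measurable borel" "g \<in> borel_measurable borel"
    and \<theta>: "\<theta> \<ge> 0" and c: "c > 0"
    and le: "AE x in lborel. norm (f x) \<le> c * norm (g x)"
  shows "Lrec \<theta> f \<le> ennreal c * Lrec \<theta> g"
proof (rule ennreal_le_cmult_of_scale[OF c])
  fix B :: real assume B: "B > 0" and *: "Lrec \<theta> g \<le> ennreal B"
  show "Lrec \<theta> f \<le> ennreal (c * B)"
  proof (cases "\<theta> = 0")
    case True
    then have "AE x in lborel. norm (g x) \<le> B"
      using * B Lrec_0_le_iff[of g B] by auto
    with le have "AE x in lborel. norm (f x) \<le> c * B"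
      by eventually_elim (use c in \<open>meson mult_le_cancel_left_pos order_trans\<close>)
    then show ?thesis using True B c Lrec_0_le_iff[of f "c * B"] by auto
  next
    case False
    with \<theta> have \<theta>: "\<theta> > 0" by simp
    have "(\<integral>\<^sup>+ x. ennreal (norm (f x) powr (1 / \<theta>)) \<partial>lborel)
        \<le> (\<integral>\<^sup>+ x. ennreal (c powr (1/\<theta>)) * ennreal (norm (g x) powr (1 / \<theta>)) \<partial>lborel)"
    proof (intro nn_integral_mono_AE, use le in eventually_elim)
      case (elim x)
      then have "norm (f x) powr (1 / \<theta>) \<le> (c * norm (g x)) powr (1 / \<theta>)"
        using \<theta> by (intro powr_mono2) auto
      then show ?case
        using c by (simp add: powr_mult flip: ennreal_mult)
    qed
    also have "\<dots> = ennreal (c powr (1/\<theta>)) * (\<integral>\<^sup>+ x. ennreal (norm (g x) powr (1 / \<theta>)) \<partial>lborel)"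
      by (intro nn_integral_cmult) measurable
    also have "\<dots> \<le> ennreal (c powr (1/\<theta>)) * ennreal (B powr (1/\<theta>))"
      using * \<theta> B Lrec_pos_le_iff[of \<theta> B g] by (intro mult_left_mono) auto
    also have "\<dots> = ennreal ((c * B) powr (1/\<theta>))"
      using B c by (simp add: powr_mult ennreal_mult)
    finally show ?thesis
      using \<theta> B c by (subst Lrec_pos_le_iff) auto
  qed
qed

lemma sum_powr_le_powr_sum:
  fixes b :: "'i \<Rightarrow> real"
  assumes "finite I" "\<And>i. i \<in> I \<Longrightarrow> b i \<ge> 0" and a: "a \<ge> 1"
  shows "(\<Sum>i\<in>I. b i powr a) \<le> (\<Sum>i\<in>I. b i) powr a"
proof -
  let ?S = "\<Sum>i\<in>I. b i"
  have S: "?S \<ge> 0" using assms by (intro sum_nonneg)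
  have split: "x powr a = x * x powr (a - 1)" if "x \<ge> 0" for x :: real
    using that by (cases "x = 0") (auto simp: powr_diff)
  have "(\<Sum>i\<in>I. b i powr a) = (\<Sum>i\<in>I. b i * b i powr (a - 1))"
    using assms by (intro sum.cong) (auto simp: split)
  also have "\<dots> \<le> (\<Sum>i\<in>I. b i * ?S powr (a - 1))"
    using assms by (intro sum_mono mult_left_mono powr_mono2 member_le_sum) auto
  also have "\<dots> = ?S powr a"
    using split[OF S] by (simp add: sum_distrib_right)
  finally show ?thesis .
qed

text \<open>
  A substitute for Minkowski's inequality: if at almost every point some \<open>f\<^sub>i\<close> dominates \<open>h\<close>, the \<open>p\<close>-th power of
  \<open>|h|\<close> is at most the sum of those of the \<open>f\<^sub>i\<close>. It serves both for the maximal component of \<open>\<xi>\<close> and for the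
  splitting into low and high frequencies.
\<close>

lemma Lrec_le_sum_of_cover:
  fixes h :: "'a::euclidean_space \<Rightarrow> 'b::real_normed_vector"
    and f :: "'i \<Rightarrow> 'a \<Rightarrow> 'c::real_normed_vector"
  assumes I: "finite I"
    and [measurable]: "h \<in> borel_measurable borel"
    and f[measurable]: "\<And>i. i \<in> I \<Longrightarrow> f i \<in> borel_measurable borel"
    and \<theta>: "0 \<le> \<theta>" "\<theta> \<le> 1"
    and le: "AE x in lborel. \<exists>i\<in>I. norm (h x) \<le> norm (f i x)"
  shows "Lrec \<theta> h \<le> (\<Sum>i\<in>I. Lrec \<theta> (f i))"
proof (cases "\<exists>i\<in>I. Lrec \<theta> (f i) = \<infinity>")
  case True
  then obtain i where i: "i \<in> I" "Lrec \<theta> (f i) = \<infinity>" by blast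
  then have "Lrec \<theta> (f i) \<le> (\<Sum>i\<in>I. Lrec \<theta> (f i))"
    using I by (intro member_le_sum) auto
  then show ?thesis using i by (simp add: top_unique)
next
  case False
  define B where "B i = enn2real (Lrec \<theta> (f i))" for i
  have B: "Lrec \<theta> (f i) = ennreal (B i)" if "i \<in> I" for i
    using False that by (simp add: B_def less_top)
  have B0: "B i \<ge> 0" for i by (simp add: B_def)
  have S0: "sum B I \<ge> 0" by (intro sum_nonneg B0)
  have "Lrec \<theta> h \<le> ennreal (sum B I)"
  proof (cases "\<theta> = 0")
    case True
    have "\<forall>i\<in>I. AE x in lborel. norm (f i x) \<le> B i"
    proof
      fix i assume i: "i \<in> I"
      show "AE x in lborel. norm (f i x) \<le> B i"
        using Lrec_0_le_iff[OF f[OF i] B0[of i]] B[OF i] True by auto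
    qed
    then have "AE x in lborel. \<forall>i\<in>I. norm (f i x) \<le> B i"
      using I by (simp add: AE_finite_all)
    with le have "AE x in lborel. norm (h x) \<le> sum B I"
    proof eventually_elim
      case (elim x)
      then obtain i where i: "i \<in> I" "norm (h x) \<le> B i" by force
      have "B i \<le> sum B I" using i I B0 by (intro member_le_sum) auto
      then show ?case using i by simp
    qed
    then show ?thesis using True S0 Lrec_0_le_iff[of h "sum B I"] by auto
  next
    case False
    with \<theta> have \<theta>': "\<theta> > 0" by simp
    have "(\<integral>\<^sup>+ x. ennreal (norm (h x) powr (1 / \<theta>)) \<partial>lborel)
        \<le> (\<integral>\<^sup>+ x. (\<Sum>i\<in>I. ennreal (norm (f i x) powr (1 / \<theta>))) \<partial>lborel)"
    proof (intro nn_integral_mono_AE, use le in eventually_elim)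
      case (elim x)
      then obtain i where i: "i \<in> I" "norm (h x) \<le> norm (f i x)" by auto
      then have "ennreal (norm (h x) powr (1 / \<theta>)) \<le> ennreal (norm (f i x) powr (1 / \<theta>))"
        using \<theta>' by (intro ennreal_leI powr_mono2) auto
      also have "\<dots> \<le> (\<Sum>i\<in>I. ennreal (norm (f i x) powr (1 / \<theta>)))"
        using i I by (intro member_le_sum) auto
      finally show ?case .
    qed
    also have "\<dots> = (\<Sum>i\<in>I. \<integral>\<^sup>+ x. ennreal (norm (f i x) powr (1 / \<theta>)) \<partial>lborel)"
      by (intro nn_integral_sum) measurable
    also have "\<dots> \<le> (\<Sum>i\<in>I. ennreal (B i powr (1 / \<theta>)))"
      using B by (intro sum_mono Lrec_pos_le_iff[OF \<theta>' B0, THEN iffD1]) simp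
    also have "\<dots> = ennreal (\<Sum>i\<in>I. B i powr (1 / \<theta>))"
      using B0 by (subst sum_ennreal) auto
    also have "\<dots> \<le> ennreal (sum B I powr (1 / \<theta>))"
      using I B0 \<theta> \<theta>' by (intro ennreal_leI sum_powr_le_powr_sum) auto
    finally show ?thesis
      using \<theta>' S0 by (subst Lrec_pos_le_iff) auto
  qed
  also have "\<dots> = (\<Sum>i\<in>I. Lrec \<theta> (f i))"
    using B B0 by (simp add: sum_ennreal flip: sum_ennreal)
  finally show ?thesis .
qed

text \<open>
  For exponents different from \<open>\<infinity>\<close> this is Young's inequality, applied pointwise to \<open>|f|/A\<close> and \<open>|g|/B\<close>
  and integrated.
\<close>

lemma Lrec_Hoelder:
  fixes h :: "'a::euclidean_space \<Rightarrow> 'b::real_normed_vector"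
    and f :: "'a \<Rightarrow> 'c::real_normed_vector" and g :: "'a \<Rightarrow> 'd::real_normed_vector"
  assumes h[measurable]: "h \<in> borel_measurable borel"
    and f[measurable]: "f \<in> borel_measurable borel"
    and g[measurable]: "g \<in> borel_measurable borel"
    and \<alpha>: "\<alpha> \<ge> 0" and \<beta>: "\<beta> \<ge> 0" and A: "A > 0" "Lrec \<alpha> f \<le> ennreal A"
    and le: "AE x in lborel. norm (h x) \<le> norm (f x) * norm (g x)"
  shows "Lrec (\<alpha> + \<beta>) h \<le> ennreal A * Lrec \<beta> g"
proof (cases "\<alpha> = 0")
  case True
  then have "AE x in lborel. norm (f x) \<le> A"
    using A Lrec_0_le_iff[of f A] by auto
  with le have "AE x in lborel. norm (h x) \<le> A * norm (g x)"
  proof eventually_elim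
    case (elim x)
    then show ?case by (meson mult_right_mono norm_ge_zero order_trans)
  qed
  then show ?thesis using True A \<beta> Lrec_mono[OF h g, of \<beta> A] by simp
next
  case False
  with \<alpha> have \<alpha>: "\<alpha> > 0" by simp
  show ?thesis
  proof (cases "\<beta> = 0")
    case True
    show ?thesis
    proof (rule ennreal_le_cmult_of_scale[OF A(1)])
      fix B :: real assume B: "B > 0" "Lrec \<beta> g \<le> ennreal B"
      then have "AE x in lborel. norm (g x) \<le> B"
        using True Lrec_0_le_iff[of g B] by auto
      with le have "AE x in lborel. norm (h x) \<le> B * norm (f x)"
      proof eventually_elim
        case (elim x)
        have "norm (f x) * norm (g x) \<le> norm (f x) * B"
          using elim by (intro mult_left_mono) auto
        then show ?case using elim by (simp add: mult.commute)
      qed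
      then have "Lrec \<alpha> h \<le> ennreal B * Lrec \<alpha> f"
        using \<alpha> B by (intro Lrec_mono) auto
      also have "\<dots> \<le> ennreal B * ennreal A"
        using A by (intro mult_left_mono) auto
      finally show "Lrec (\<alpha> + \<beta>) h \<le> ennreal (A * B)"
        using True A B by (simp add: ennreal_mult mult.commute)
    qed
  next
    case False
    with \<beta> have \<beta>: "\<beta> > 0" by simp
    show ?thesis
    proof (rule ennreal_le_cmult_of_scale[OF A(1)])
      fix B :: real assume B: "B > 0" "Lrec \<beta> g \<le> ennreal B"
      define c where "c = 1 / (\<alpha> + \<beta>)"
      have c: "c > 0" using \<alpha> \<beta> by (simp add: c_def)
      have c\<alpha>: "c * ((\<alpha> + \<beta>) / \<alpha>) = 1 / \<alpha>" and c\<beta>: "c * ((\<alpha> + \<beta>) / \<beta>) = 1 / \<beta>"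
        using \<alpha> \<beta> by (simp_all add: c_def)
      have young: "(u * v) powr c \<le> (A * B) powr c *
            (c * \<alpha> * A powr (- (1/\<alpha>)) * u powr (1 / \<alpha>) + c * \<beta> * B powr (- (1/\<beta>)) * v powr (1 / \<beta>))"
        if uv: "u \<ge> 0" "v \<ge> 0" for u v
      proof -
        have "(u / A) powr c * (v / B) powr c
          \<le> ((u / A) powr c) powr ((\<alpha> + \<beta>) / \<alpha>) / ((\<alpha> + \<beta>) / \<alpha>)
            + ((v / B) powr c) powr ((\<alpha> + \<beta>) / \<beta>) / ((\<alpha> + \<beta>) / \<beta>)"
          using \<alpha> \<beta> uv A B
          by (intro Youngs_inequality) (auto simp: add_divide_distrib[symmetric])
        also have "\<dots> = c * \<alpha> * (u / A) powr (1 / \<alpha>) + c * \<beta> * (v / B) powr (1 / \<beta>)"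
          unfolding powr_powr c\<alpha> c\<beta> by (simp add: c_def field_simps)
        also have "\<dots> = c * \<alpha> * A powr (- (1/\<alpha>)) * u powr (1 / \<alpha>) + c * \<beta> * B powr (- (1/\<beta>)) * v powr (1 / \<beta>)"
          using uv A B by (simp add: powr_divide powr_minus_divide)
        finally have "(A * B) powr c * ((u / A) powr c * (v / B) powr c) \<le> (A * B) powr c * \<dots>"
          by (intro mult_left_mono) auto
        moreover have "(A * B) powr c * ((u / A) powr c * (v / B) powr c) = (u * v) powr c"
          using A B uv by (simp add: powr_mult powr_divide)
        ultimately show ?thesis by simp
      qed
      let ?P = "\<lambda>x. ennreal (norm (f x) powr (1 / \<alpha>))"
      let ?Q = "\<lambda>x. ennreal (norm (g x) powr (1 / \<beta>))"
      have "(\<integral>\<^sup>+ x. ennreal (norm (h x) powr c) \<partial>lborel)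
        \<le> (\<integral>\<^sup>+ x. ennreal ((A * B) powr c) * (ennreal (c * \<alpha> * A powr (- (1/\<alpha>))) * ?P x
              + ennreal (c * \<beta> * B powr (- (1/\<beta>))) * ?Q x) \<partial>lborel)"
      proof (intro nn_integral_mono_AE, use le in eventually_elim)
        case (elim x)
        then have "norm (h x) powr c \<le> (norm (f x) * norm (g x)) powr c"
          using c by (intro powr_mono2) auto
        also note young[of "norm (f x)" "norm (g x)"]
        finally have "ennreal (norm (h x) powr c) \<le> ennreal ((A * B) powr c *
            (c * \<alpha> * A powr (- (1/\<alpha>)) * norm (f x) powr (1 / \<alpha>)
              + c * \<beta> * B powr (- (1/\<beta>)) * norm (g x) powr (1 / \<beta>)))"
          by (intro ennreal_leI) auto
        then show ?case
          using c \<alpha> \<beta> by (simp add: ennreal_mult ennreal_plus)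
      qed
      also have "\<dots> = ennreal ((A * B) powr c) * (ennreal (c * \<alpha> * A powr (- (1/\<alpha>))) * integral\<^sup>N lborel ?P
              + ennreal (c * \<beta> * B powr (- (1/\<beta>))) * integral\<^sup>N lborel ?Q)"
        by (simp add: nn_integral_cmult nn_integral_add)
      also have "\<dots> \<le> ennreal ((A * B) powr c) *
          (ennreal (c * \<alpha> * A powr (- (1/\<alpha>))) * ennreal (A powr (1 / \<alpha>))
              + ennreal (c * \<beta> * B powr (- (1/\<beta>))) * ennreal (B powr (1 / \<beta>)))"
        using A B Lrec_pos_le_iff[of \<alpha> A f] Lrec_pos_le_iff[of \<beta> B g] \<alpha> \<beta>
        by (intro mult_left_mono add_mono) auto
      also have "\<dots> = ennreal ((A * B) powr c * (c * \<alpha> * (A powr (- (1/\<alpha>)) * A powr (1 / \<alpha>))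
              + c * \<beta> * (B powr (- (1/\<beta>)) * B powr (1 / \<beta>))))"
        using c \<alpha> \<beta> by (simp add: ennreal_mult ennreal_plus mult.assoc)
      also have "(A * B) powr c * (c * \<alpha> * (A powr (- (1/\<alpha>)) * A powr (1 / \<alpha>))
              + c * \<beta> * (B powr (- (1/\<beta>)) * B powr (1 / \<beta>))) = (A * B) powr c * (c * (\<alpha> + \<beta>))"
        using A B by (simp add: powr_minus field_simps)
      also have "\<dots> = (A * B) powr c" using \<alpha> \<beta> by (simp add: c_def)
      finally show "Lrec (\<alpha> + \<beta>) h \<le> ennreal (A * B)"
        using A B \<alpha> \<beta> by (subst Lrec_pos_le_iff) (auto simp: c_def)
    qed
  qed
qed

lemma nn_integral_dilate:
  fixes f :: "'a::euclidean_space \<Rightarrow> ennreal"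
  assumes [measurable]: "f \<in> borel_measurable borel" and c: "c > 0"
  shows "(\<integral>\<^sup>+ x. f (c *\<^sub>R x) \<partial>lborel) = ennreal (c powr (- real DIM('a))) * (\<integral>\<^sup>+ x. f x \<partial>lborel)"
proof -
  have "(\<integral>\<^sup>+ x. f x \<partial>lborel) = ennreal (c ^ DIM('a)) * (\<integral>\<^sup>+ x. f (c *\<^sub>R x) \<partial>lborel)"
    using c by (subst lborel_affine[of c "0::'a"])
      (auto simp: nn_integral_density nn_integral_distr nn_integral_cmult)
  moreover have "ennreal (c powr (- real DIM('a))) * ennreal (c ^ DIM('a)) = 1"
    using c by (simp add: powr_minus powr_realpow flip: ennreal_mult)
  ultimately show ?thesis by (simp add: mult.assoc[symmetric])
qed

lemma AE_lborel_dilate: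
  fixes P :: "'a::euclidean_space \<Rightarrow> bool"
  assumes [measurable]: "Measurable.pred borel P" and c: "c > 0" and P: "AE x in lborel. P x"
  shows "AE x in lborel. P (c *\<^sub>R x)"
proof -
  have "(\<integral>\<^sup>+ x. indicator {x. \<not> P x} (c *\<^sub>R x) \<partial>lborel) = 0"
    using P c by (subst nn_integral_dilate) (auto simp: AE_iff_nn_integral)
  then show ?thesis
    by (subst (asm) nn_integral_0_iff_AE) (auto simp: indicator_def split: if_splits)
qed

lemma Lrec_dilate:
  fixes f :: "'a::euclidean_space \<Rightarrow> 'b::real_normed_vector"
  assumes [measurable]: "f \<in> borel_measurable borel" and c: "c > 0" and \<theta>: "\<theta> \<ge> 0"
    and B: "B \<ge> 0" "Lrec \<theta> f \<le> ennreal B"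
  shows "Lrec \<theta> (\<lambda>x. f (c *\<^sub>R x)) \<le> ennreal (c powr (- real DIM('a) * \<theta>) * B)"
proof (cases "\<theta> = 0")
  case True
  then have "AE x in lborel. norm (f x) \<le> B" using B Lrec_0_le_iff[of f B] by auto
  then have "AE x in lborel. norm (f (c *\<^sub>R x)) \<le> B"
    by (intro AE_lborel_dilate[of "\<lambda>x. norm (f x) \<le> B"] c) auto
  then show ?thesis using True B c Lrec_0_le_iff[of "\<lambda>x. f (c *\<^sub>R x)" B] by auto
next
  case False
  with \<theta> have \<theta>: "\<theta> > 0" by simp
  have "(\<integral>\<^sup>+ x. ennreal (norm (f (c *\<^sub>R x)) powr (1 / \<theta>)) \<partial>lborel)
      = ennreal (c powr (- real DIM('a))) * (\<integral>\<^sup>+ x. ennreal (norm (f x) powr (1 / \<theta>)) \<partial>lborel)"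
    using c by (intro nn_integral_dilate) measurable
  also have "\<dots> \<le> ennreal (c powr (- real DIM('a))) * ennreal (B powr (1 / \<theta>))"
    using B \<theta> Lrec_pos_le_iff[of \<theta> B f] by (intro mult_left_mono) auto
  also have "\<dots> = ennreal ((c powr (- real DIM('a) * \<theta>) * B) powr (1 / \<theta>))"
    using B \<theta> by (simp add: powr_mult powr_powr ennreal_mult)
  finally show ?thesis
    using \<theta> B by (subst Lrec_pos_le_iff) auto
qed

section \<open>Plancherel's inequality\<close>

lemma measurable_cis[measurable]: "cis \<in> borel_measurable borel"
  by (intro borel_measurable_continuous_onI continuous_intros)

lemma borel_measurable_cnj[measurable]: "cnj \<in> borel_measurable borel"
  by (intro borel_measurable_continuous_onI continuous_intros)

lemma borel_measurable_fourier[measurable]: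
  fixes f :: "real ^ 'n::finite \<Rightarrow> complex"
  assumes [measurable]: "f \<in> borel_measurable borel"
  shows "fourier f \<in> borel_measurable borel"
  unfolding fourier_def[abs_def] by measurable

lemma norm_fourier_le: "norm (fourier f \<xi>) \<le> (LINT x|lborel. norm (f x))"
  unfolding fourier_def
  by (rule order_trans[OF integral_norm_bound]) (simp add: norm_mult)

lemma integrable_mult_cis:
  fixes f :: "'a::euclidean_space \<Rightarrow> complex" and u :: "'a \<Rightarrow> real"
  assumes "integrable lborel f" and [measurable]: "u \<in> borel_measurable borel"
  shows "integrable lborel (\<lambda>x. f x * cis (u x))"
  by (rule Bochner_Integration.integrable_bound[OF assms(1)])
     (use assms(1) in \<open>auto simp: norm_mult dest: borel_measurable_integrable\<close>)

text \<open>
  Fubini's theorem for \<open>f(x) g(\<xi>) e\<^bsup>-2\<pi>i x\<cdot>\<xi>\<^esup>\<close>. This is the only exchange of oscillatory integrals in the proof of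
  Plancherel's inequality, where it is used twice.
\<close>

lemma integral_fourier_mult:
  fixes f g :: "real ^ 'n::finite \<Rightarrow> complex"
  assumes f: "integrable lborel f" and g: "integrable lborel g"
  shows "(LINT \<xi>|lborel. fourier f \<xi> * g \<xi>) = (LINT x|lborel. f x * fourier g x)"
proof -
  have [measurable]: "f \<in> borel_measurable borel" "g \<in> borel_measurable borel"
    using f g by (auto dest: borel_measurable_integrable)
  let ?h = "\<lambda>x \<xi>. f x * g \<xi> * cis (- (2 * pi * (x \<bullet> \<xi>)))"
  have "integrable (lborel \<Otimes>\<^sub>M lborel) (case_prod ?h)"
  proof (rule lborel_pair.Fubini_integrable)
    have "(\<lambda>x. LINT y|lborel. norm (case (x, y) of (x, y) \<Rightarrow> ?h x y))
        = (\<lambda>x. norm (f x) * (LINT y|lborel. norm (g y)))"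
      by (simp add: norm_mult)
    then show "integrable lborel (\<lambda>x. LINT y|lborel. norm (case (x, y) of (x, y) \<Rightarrow> ?h x y))"
      using f by (simp add: integrable_norm)
    show "AE x in lborel. integrable lborel (\<lambda>y. case (x, y) of (x, y) \<Rightarrow> ?h x y)"
    proof (rule AE_I2)
      fix x
      have "integrable lborel (\<lambda>y. f x * (g y * cis (- (2 * pi * (x \<bullet> y)))))"
        by (intro integrable_mult_right integrable_mult_cis g) measurable
      then show "integrable lborel (\<lambda>y. case (x, y) of (x, y) \<Rightarrow> ?h x y)"
        by (simp add: mult.assoc)
    qed
  qed measurable
  then have "(LINT \<xi>|lborel. LINT x|lborel. ?h x \<xi>) = (LINT x|lborel. LINT \<xi>|lborel. ?h x \<xi>)"
    by (rule lborel_pair.Fubini_integral)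
  moreover have "(LINT x|lborel. ?h x \<xi>) = fourier f \<xi> * g \<xi>" for \<xi>
  proof -
    have "(LINT x|lborel. ?h x \<xi>) = (LINT x|lborel. (f x * cis (- (2 * pi * (x \<bullet> \<xi>)))) * g \<xi>)"
      by (simp add: mult_ac)
    then show ?thesis by (simp add: fourier_def)
  qed
  moreover have "(LINT \<xi>|lborel. ?h x \<xi>) = f x * fourier g x" for x
  proof -
    have "(LINT \<xi>|lborel. ?h x \<xi>) = (LINT \<xi>|lborel. f x * (g \<xi> * cis (- (2 * pi * (\<xi> \<bullet> x)))))"
      by (simp add: mult_ac inner_commute)
    then show ?thesis by (simp add: fourier_def)
  qed
  ultimately show ?thesis by simp
qed

lemma lborel_prod_integral:
  fixes h :: "'a::euclidean_space \<Rightarrow> real \<Rightarrow> complex"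
  assumes h: "\<And>b. b \<in> Basis \<Longrightarrow> integrable lborel (h b)"
  shows "integrable lborel (\<lambda>x::'a. \<Prod>b\<in>Basis. h b (x \<bullet> b))"
    and "(LINT x|lborel. (\<Prod>b\<in>(Basis::'a set). h b (x \<bullet> b))) = (\<Prod>b\<in>Basis. LINT s|lborel. h b s)"
proof -
  interpret product_sigma_finite "\<lambda>_. lborel :: real measure" ..
  have [measurable]: "h b \<in> borel_measurable borel" if "b \<in> Basis" for b
    using h[OF that] by (auto dest: borel_measurable_integrable)
  let ?T = "\<lambda>f::'a \<Rightarrow> real. \<Sum>b\<in>Basis. f b *\<^sub>R b"
  have T[measurable]: "?T \<in> measurable (\<Pi>\<^sub>M b\<in>Basis. lborel) borel"
    by measurable
  have comp: "(\<Prod>b\<in>Basis. h b (?T f \<bullet> b)) = (\<Prod>b\<in>Basis. h b (f b))" for f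
    by (intro prod.cong) (auto simp: inner_sum_left inner_Basis if_distrib cong: if_cong)
  have int: "integrable (\<Pi>\<^sub>M b\<in>Basis. lborel) (\<lambda>f. \<Prod>b\<in>Basis. h b (f b))"
    by (intro product_integrable_prod h) auto
  show "integrable lborel (\<lambda>x::'a. \<Prod>b\<in>Basis. h b (x \<bullet> b))"
    by (subst lborel_eq, subst integrable_distr_eq) (use int in \<open>simp_all add: comp\<close>)
  have "(LINT x|lborel. (\<Prod>b\<in>(Basis::'a set). h b (x \<bullet> b)))
      = (LINT f|(\<Pi>\<^sub>M b\<in>Basis. lborel). (\<Prod>b\<in>(Basis::'a set). h b (f b)))"
    by (subst lborel_eq, subst integral_distr) (simp_all add: comp)
  also have "\<dots> = (\<Prod>b\<in>Basis. LINT s|lborel. h b s)"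
    by (intro product_integral_prod h) auto
  finally show "(LINT x|lborel. (\<Prod>b\<in>(Basis::'a set). h b (x \<bullet> b))) = (\<Prod>b\<in>Basis. LINT s|lborel. h b s)" .
qed

definition gauss :: "real \<Rightarrow> 'a::euclidean_space \<Rightarrow> real" where
  "gauss m \<xi> = (\<Prod>b\<in>Basis. exp (- ((\<xi> \<bullet> b) / m)\<^sup>2 / 2))"

text \<open>
  The Fourier transform of \<open>gauss m\<close>: the product of centred normal densities of standard deviation
  \<open>1 / (2\<pi>m)\<close>.
\<close>

definition gauss_kernel :: "real \<Rightarrow> 'a::euclidean_space \<Rightarrow> real" where
  "gauss_kernel m x = (\<Prod>b\<in>Basis. normal_density 0 (1 / (2 * pi * m)) (x \<bullet> b))"

lemma measurable_gauss[measurable]: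
  "gauss m \<in> borel_measurable borel" "gauss_kernel m \<in> borel_measurable borel"
  unfolding gauss_def[abs_def] gauss_kernel_def[abs_def] by measurable

lemma gauss_nonneg: "gauss m \<xi> \<ge> 0" and gauss_kernel_nonneg: "gauss_kernel m x \<ge> 0"
  by (auto simp: gauss_def gauss_kernel_def intro!: prod_nonneg)

text \<open>
  The characteristic function of the standard normal distribution, without the normalising factor.
\<close>

lemma std_normal_fourier:
  "(LINT x|lborel. complex_of_real (exp (- x\<^sup>2 / 2)) * cis (t * x))
     = complex_of_real (sqrt (2 * pi) * exp (- t\<^sup>2 / 2))"
  "integrable lborel (\<lambda>x. complex_of_real (exp (- x\<^sup>2 / 2)))"
proof -
  have e: "exp (- x\<^sup>2 / 2) = sqrt (2 * pi) * std_normal_density x" for x :: real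
    by (simp add: normal_density_def)
  have "complex_of_real (exp (- t\<^sup>2 / 2)) = char std_normal_distribution t"
    by (simp add: char_std_normal_distribution)
  also have "\<dots> = (LINT x|lborel. std_normal_density x *\<^sub>R cis (t * x))"
    unfolding char_def by (subst integral_density) (auto simp: cis_conv_exp normal_density_nonneg)
  finally have *: "complex_of_real (exp (- t\<^sup>2 / 2)) = (LINT x|lborel. std_normal_density x *\<^sub>R cis (t * x))" .
  have "(LINT x|lborel. complex_of_real (exp (- x\<^sup>2 / 2)) * cis (t * x))
      = (LINT x|lborel. complex_of_real (sqrt (2 * pi)) * (std_normal_density x *\<^sub>R cis (t * x)))"
    unfolding e by (simp add: scaleR_conv_of_real mult.assoc)
  also have "\<dots> = complex_of_real (sqrt (2 * pi)) * (LINT x|lborel. std_normal_density x *\<^sub>R cis (t * x))"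
    by (rule integral_mult_right_zero)
  also have "\<dots> = complex_of_real (sqrt (2 * pi) * exp (- t\<^sup>2 / 2))"
    by (simp only: *[symmetric] of_real_mult)
  finally show "(LINT x|lborel. complex_of_real (exp (- x\<^sup>2 / 2)) * cis (t * x))
     = complex_of_real (sqrt (2 * pi) * exp (- t\<^sup>2 / 2))" .
  show "integrable lborel (\<lambda>x. complex_of_real (exp (- x\<^sup>2 / 2)))"
    unfolding e by (intro integrable_of_real integrable_mult_right) auto
qed

lemma gauss_fourier_1:
  assumes m: "m > 0"
  shows "(LINT s|lborel. complex_of_real (exp (- (s / m)\<^sup>2 / 2)) * cis (2 * pi * (s * z)))
     = complex_of_real (normal_density 0 (1 / (2 * pi * m)) z)"
    and "integrable lborel (\<lambda>s. complex_of_real (exp (- (s / m)\<^sup>2 / 2)))"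
proof -
  have "(LINT s|lborel. complex_of_real (exp (- (s / m)\<^sup>2 / 2)) * cis (2 * pi * (s * z)))
    = \<bar>m\<bar> *\<^sub>R (LINT x|lborel. complex_of_real (exp (- ((0 + m * x) / m)\<^sup>2 / 2)) * cis (2 * pi * ((0 + m * x) * z)))"
    using m by (intro lborel_integral_real_affine) auto
  also have "\<dots> = m *\<^sub>R (LINT x|lborel. complex_of_real (exp (- x\<^sup>2 / 2)) * cis ((2 * pi * m * z) * x))"
    using m by (simp add: mult_ac)
  also have "\<dots> = complex_of_real (m * sqrt (2 * pi) * exp (- (2 * pi * m * z)\<^sup>2 / 2))"
    unfolding std_normal_fourier by (simp add: scaleR_conv_of_real)
  also have "m * sqrt (2 * pi) * exp (- (2 * pi * m * z)\<^sup>2 / 2) = normal_density 0 (1 / (2 * pi * m)) z"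
  proof -
    have "1 / sqrt (2 * pi * (1 / (2 * pi * m))\<^sup>2) = m * sqrt (2 * pi)"
    proof -
      have "2 * pi * (1 / (2 * pi * m))\<^sup>2 = 1 / (m\<^sup>2 * (2 * pi))"
        using m by (simp add: power2_eq_square field_simps)
      then show ?thesis using m by (simp add: real_sqrt_divide real_sqrt_mult)
    qed
    moreover have "- (2 * pi * m * z)\<^sup>2 / 2 = - (z - 0)\<^sup>2 / (2 * (1 / (2 * pi * m))\<^sup>2)"
      using m by (simp add: power2_eq_square field_simps)
    ultimately show ?thesis unfolding normal_density_def by simp
  qed
  finally show "(LINT s|lborel. complex_of_real (exp (- (s / m)\<^sup>2 / 2)) * cis (2 * pi * (s * z)))
     = complex_of_real (normal_density 0 (1 / (2 * pi * m)) z)" .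
  show "integrable lborel (\<lambda>s. complex_of_real (exp (- (s / m)\<^sup>2 / 2)))"
    using lborel_integrable_real_affine[OF std_normal_fourier(2), of "1/m" 0] m by simp
qed

lemma cis_sum: "finite A \<Longrightarrow> cis (\<Sum>i\<in>A. f i) = (\<Prod>i\<in>A. cis (f i))"
  by (induction A rule: finite_induct) (auto simp: cis_mult[symmetric])

lemma gauss_fourier:
  fixes x y :: "real ^ 'n::finite"
  assumes m: "m > 0"
  shows "fourier (\<lambda>\<xi>. complex_of_real (gauss m \<xi>) * cis (2 * pi * (\<xi> \<bullet> x))) y
      = complex_of_real (gauss_kernel m (x - y))"
    and "integrable lborel (\<lambda>\<xi>::real ^ 'n. complex_of_real (gauss m \<xi>))"
proof -
  let ?g = "\<lambda>s. complex_of_real (exp (- (s / m)\<^sup>2 / 2))"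
  have "fourier (\<lambda>\<xi>. complex_of_real (gauss m \<xi>) * cis (2 * pi * (\<xi> \<bullet> x))) y
    = (LINT \<xi>|lborel. (\<Prod>b\<in>Basis. ?g (\<xi> \<bullet> b) * cis (2 * pi * ((\<xi> \<bullet> b) * ((x - y) \<bullet> b)))))"
    unfolding fourier_def
  proof (rule Bochner_Integration.integral_cong[OF refl])
    fix \<xi> :: "real ^ 'n"
    have "cis (2 * pi * (\<xi> \<bullet> x)) * cis (- (2 * pi * (\<xi> \<bullet> y))) = cis (2 * pi * (\<xi> \<bullet> (x - y)))"
      by (simp add: cis_mult inner_diff_right algebra_simps)
    also have "2 * pi * (\<xi> \<bullet> (x - y)) = (\<Sum>b\<in>Basis. 2 * pi * ((\<xi> \<bullet> b) * ((x - y) \<bullet> b)))"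
      by (subst euclidean_inner) (simp add: sum_distrib_left)
    finally show "complex_of_real (gauss m \<xi>) * cis (2 * pi * (\<xi> \<bullet> x)) * cis (- (2 * pi * (\<xi> \<bullet> y)))
        = (\<Prod>b\<in>Basis. ?g (\<xi> \<bullet> b) * cis (2 * pi * ((\<xi> \<bullet> b) * ((x - y) \<bullet> b))))"
      by (simp add: cis_sum gauss_def prod.distrib mult.assoc)
  qed
  also have "\<dots> = (\<Prod>b\<in>Basis. LINT s|lborel. ?g s * cis (2 * pi * (s * ((x - y) \<bullet> b))))"
    by (intro lborel_prod_integral(2) integrable_mult_cis gauss_fourier_1(2) m) measurable
  also have "\<dots> = complex_of_real (gauss_kernel m (x - y))"
    by (simp only: gauss_fourier_1(1)[OF m] gauss_kernel_def of_real_prod)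
  finally show "fourier (\<lambda>\<xi>. complex_of_real (gauss m \<xi>) * cis (2 * pi * (\<xi> \<bullet> x))) y
      = complex_of_real (gauss_kernel m (x - y))" .
  have "integrable lborel (\<lambda>\<xi>::real ^ 'n. \<Prod>b\<in>Basis. ?g (\<xi> \<bullet> b))"
    by (intro lborel_prod_integral(1) gauss_fourier_1(2) m)
  then show "integrable lborel (\<lambda>\<xi>::real ^ 'n. complex_of_real (gauss m \<xi>))"
    by (simp add: gauss_def)
qed

lemma nn_integral_lborel_translate:
  fixes f :: "'a::euclidean_space \<Rightarrow> ennreal"
  assumes [measurable]: "f \<in> borel_measurable borel"
  shows "(\<integral>\<^sup>+ x. f (a + x) \<partial>lborel) = (\<integral>\<^sup>+ x. f x \<partial>lborel)"
  by (subst (2) lborel_distr_plus[of a, symmetric]) (simp add: nn_integral_distr)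

lemma nn_integral_gauss_kernel:
  fixes x :: "'a::euclidean_space"
  assumes m: "m > 0"
  shows "(\<integral>\<^sup>+ y. ennreal (gauss_kernel m (y - x)) \<partial>lborel) = 1"
    and "(\<integral>\<^sup>+ y. ennreal (gauss_kernel m (x - y)) \<partial>lborel) = 1"
proof -
  have "(\<integral>\<^sup>+ y. ennreal (gauss_kernel m (y::'a)) \<partial>lborel)
     = (\<integral>\<^sup>+ y. (\<Prod>b\<in>(Basis::'a set). ennreal (normal_density 0 (1 / (2 * pi * m)) (y \<bullet> b))) \<partial>lborel)"
    unfolding gauss_kernel_def by (subst prod_ennreal) auto
  also have "\<dots> = (\<Prod>b\<in>(Basis::'a set). (\<integral>\<^sup>+ s. ennreal (normal_density 0 (1 / (2 * pi * m)) s) \<partial>lborel))"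
    by (intro nn_integral_lborel_prod) auto
  also have "\<dots> = 1"
    using m by (subst nn_integral_eq_integral) auto
  finally have *: "(\<integral>\<^sup>+ y. ennreal (gauss_kernel m (y::'a)) \<partial>lborel) = 1" .
  show 1: "(\<integral>\<^sup>+ y. ennreal (gauss_kernel m (y - x)) \<partial>lborel) = 1"
    using nn_integral_lborel_translate[of "\<lambda>y. ennreal (gauss_kernel m y)" "- x"] * by simp
  have "gauss_kernel m (x - y) = gauss_kernel m (y - x)" for y
    unfolding gauss_kernel_def normal_density_def
    by (intro prod.cong refl) (simp add: inner_diff_left power2_commute)
  then show "(\<integral>\<^sup>+ y. ennreal (gauss_kernel m (x - y)) \<partial>lborel) = 1"
    using 1 by simp
qed

text \<open>
  Schur's test: \<open>u(x) u(y) \<le> (u(x)\<^sup>2 + u(y)\<^sup>2) / 2\<close>, and the kernel has integral one in each variable.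
\<close>

lemma gauss_kernel_form_le:
  fixes u :: "'a::euclidean_space \<Rightarrow> real"
  assumes [measurable]: "u \<in> borel_measurable borel" and u: "\<And>x. u x \<ge> 0" and m: "m > 0"
  shows "(\<integral>\<^sup>+ x. ennreal (u x) * (\<integral>\<^sup>+ y. ennreal (u y * gauss_kernel m (x - y)) \<partial>lborel) \<partial>lborel)
     \<le> (\<integral>\<^sup>+ x. ennreal ((u x)\<^sup>2) \<partial>lborel)" (is "?L \<le> ?R")
proof -
  define c where "c = (1 / 2 :: real)"
  have c: "c \<ge> 0" "c + c = 1" by (simp_all add: c_def)
  let ?K = "\<lambda>x y. ennreal (gauss_kernel m (x - y))"
  have "?L = (\<integral>\<^sup>+ x. \<integral>\<^sup>+ y. ennreal (u x) * ennreal (u y * gauss_kernel m (x - y)) \<partial>lborel \<partial>lborel)"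
    by (simp add: nn_integral_cmult)
  also have "\<dots> \<le> (\<integral>\<^sup>+ x. \<integral>\<^sup>+ y. ennreal c * (ennreal ((u x)\<^sup>2) * ?K x y)
        + ennreal c * (ennreal ((u y)\<^sup>2) * ?K x y) \<partial>lborel \<partial>lborel)"
  proof (intro nn_integral_mono)
    fix x y :: 'a
    have "u x * (u y * gauss_kernel m (x - y)) \<le> ((u x)\<^sup>2 + (u y)\<^sup>2) / 2 * gauss_kernel m (x - y)"
    proof -
      have "(u x * u y) * gauss_kernel m (x - y) \<le> ((u x)\<^sup>2 + (u y)\<^sup>2) / 2 * gauss_kernel m (x - y)"
        using sum_squares_bound[of "u x" "u y"] gauss_kernel_nonneg[of m "x - y"]
        by (intro mult_right_mono) auto
      then show ?thesis by (simp only: mult.assoc)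
    qed
    then have "ennreal (u x * (u y * gauss_kernel m (x - y)))
        \<le> ennreal (((u x)\<^sup>2 + (u y)\<^sup>2) / 2 * gauss_kernel m (x - y))"
      by (rule ennreal_leI)
    also have "((u x)\<^sup>2 + (u y)\<^sup>2) / 2 * gauss_kernel m (x - y)
      = c * ((u x)\<^sup>2 * gauss_kernel m (x - y)) + c * ((u y)\<^sup>2 * gauss_kernel m (x - y))"
      by (simp add: field_simps c_def)
    finally show "ennreal (u x) * ennreal (u y * gauss_kernel m (x - y)) \<le>
      ennreal c * (ennreal ((u x)\<^sup>2) * ?K x y) + ennreal c * (ennreal ((u y)\<^sup>2) * ?K x y)"
      using u gauss_kernel_nonneg[of m "x - y"] c
      by (simp add: ennreal_mult ennreal_plus)
  qed
  also have "\<dots> = (\<integral>\<^sup>+ x. \<integral>\<^sup>+ y. ennreal c * (ennreal ((u x)\<^sup>2) * ?K x y) \<partial>lborel \<partial>lborel)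
      + (\<integral>\<^sup>+ x. \<integral>\<^sup>+ y. ennreal c * (ennreal ((u y)\<^sup>2) * ?K x y) \<partial>lborel \<partial>lborel)"
    by (simp add: nn_integral_add)
  also have "(\<integral>\<^sup>+ x. \<integral>\<^sup>+ y. ennreal c * (ennreal ((u x)\<^sup>2) * ?K x y) \<partial>lborel \<partial>lborel) = ennreal c * ?R"
    by (simp add: nn_integral_cmult nn_integral_gauss_kernel m)
  also have "(\<integral>\<^sup>+ x. \<integral>\<^sup>+ y. ennreal c * (ennreal ((u y)\<^sup>2) * ?K x y) \<partial>lborel \<partial>lborel)
      = (\<integral>\<^sup>+ y. \<integral>\<^sup>+ x. ennreal c * (ennreal ((u y)\<^sup>2) * ?K x y) \<partial>lborel \<partial>lborel)"
    by (rule lborel_pair.Fubini') measurable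
  also have "\<dots> = ennreal c * ?R"
    by (simp add: nn_integral_cmult nn_integral_gauss_kernel m)
  also have "ennreal c * ?R + ennreal c * ?R = ?R"
    using c by (simp add: distrib_right[symmetric] flip: ennreal_plus)
  finally show ?thesis .
qed

text \<open>
  Two applications of the multiplication formula rewrite \<open>\<integral> G |f\<^sup>^|\<^sup>2\<close>, for a Gaussian \<open>G\<close>, as
  \<open>\<integral>\<integral> f(x) K(x - y) f(y)\<^sup>*\<close> with \<open>K\<close> the transform of \<open>G\<close>.
\<close>

lemma fourier_gauss_weighted:
  fixes f :: "real ^ 'n::finite \<Rightarrow> complex"
  assumes f: "integrable lborel f" and m: "m > 0"
  shows "(\<integral>\<^sup>+ \<xi>. ennreal (gauss m \<xi> * (norm (fourier f \<xi>))\<^sup>2) \<partial>lborel)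
    \<le> (\<integral>\<^sup>+ x. ennreal ((norm (f x))\<^sup>2) \<partial>lborel)"
proof -
  have [measurable]: "f \<in> borel_measurable borel"
    using f by (auto dest: borel_measurable_integrable)
  define N where "N = (LINT x|lborel. norm (f x))"
  define g where "g \<xi> = complex_of_real (gauss m \<xi>) * cnj (fourier f \<xi>)" for \<xi>
  have [measurable]: "g \<in> borel_measurable borel"
    unfolding g_def[abs_def] by measurable
  have bd: "norm (fourier f \<xi>) \<le> N" for \<xi> unfolding N_def by (rule norm_fourier_le)
  have N: "N \<ge> 0" using bd[of 0] norm_ge_zero order_trans by blast
  have G: "integrable lborel (\<lambda>\<xi>::real ^ 'n. complex_of_real (gauss m \<xi>))"
    by (rule gauss_fourier(2)[OF m])
  have g: "integrable lborel g"
  proof (rule Bochner_Integration.integrable_bound)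
    show "integrable lborel (\<lambda>\<xi>::real ^ 'n. complex_of_real N * complex_of_real (gauss m \<xi>))"
      using G by (rule integrable_mult_right)
    show "AE \<xi> in lborel. norm (g \<xi>) \<le> norm (complex_of_real N * complex_of_real (gauss m \<xi>))"
      using bd N by (auto simp: g_def norm_mult mult.commute[of N] intro!: mult_left_mono)
  qed measurable
  have Fg: "fourier g x = cnj (LINT y|lborel. f y * complex_of_real (gauss_kernel m (x - y)))" for x
  proof -
    have "fourier g x = (LINT \<xi>|lborel. cnj (fourier f \<xi> * (complex_of_real (gauss m \<xi>) * cis (2 * pi * (\<xi> \<bullet> x)))))"
      unfolding fourier_def[of g] by (intro Bochner_Integration.integral_cong) (auto simp: g_def cis_cnj mult_ac)
    also have "\<dots> = cnj (LINT \<xi>|lborel. fourier f \<xi> * (complex_of_real (gauss m \<xi>) * cis (2 * pi * (\<xi> \<bullet> x))))"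
      by (rule Bochner_Integration.integral_cnj)
    also have "(LINT \<xi>|lborel. fourier f \<xi> * (complex_of_real (gauss m \<xi>) * cis (2 * pi * (\<xi> \<bullet> x))))
       = (LINT y|lborel. f y * complex_of_real (gauss_kernel m (x - y)))"
      by (subst integral_fourier_mult[OF f])
         (auto simp: gauss_fourier(1)[OF m] intro!: integrable_mult_cis G)
    finally show ?thesis .
  qed
  have "norm (fourier g x) \<le> (\<integral>\<^sup>+ y. ennreal (norm (f y) * gauss_kernel m (x - y)) \<partial>lborel)" for x
  proof -
    have "ennreal (norm (fourier g x)) = ennreal (norm (LINT y|lborel. f y * complex_of_real (gauss_kernel m (x - y))))"
      by (simp add: Fg)
    also have "\<dots> \<le> (\<integral>\<^sup>+ y. ennreal (norm (f y * complex_of_real (gauss_kernel m (x - y)))) \<partial>lborel)"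
      by (cases "integrable lborel (\<lambda>y. f y * complex_of_real (gauss_kernel m (x - y)))")
         (auto intro: integral_norm_bound_ennreal simp: not_integrable_integral_eq)
    also have "\<dots> = (\<integral>\<^sup>+ y. ennreal (norm (f y) * gauss_kernel m (x - y)) \<partial>lborel)"
      by (simp add: norm_mult gauss_kernel_nonneg)
    finally show ?thesis .
  qed
  note Fg_le = this
  have Ffg: "fourier f \<xi> * g \<xi> = complex_of_real (gauss m \<xi> * (norm (fourier f \<xi>))\<^sup>2)" for \<xi>
    using complex_norm_square[of "fourier f \<xi>"] by (simp add: g_def mult_ac)
  have int: "integrable lborel (\<lambda>\<xi>. fourier f \<xi> * g \<xi>)"
  proof (rule Bochner_Integration.integrable_bound)
    show "integrable lborel (\<lambda>\<xi>. complex_of_real N * g \<xi>)"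
      using g by (rule integrable_mult_right)
    show "AE \<xi> in lborel. norm (fourier f \<xi> * g \<xi>) \<le> norm (complex_of_real N * g \<xi>)"
      using bd N by (auto simp: norm_mult intro!: mult_right_mono)
  qed measurable
  have int': "integrable lborel (\<lambda>\<xi>. gauss m \<xi> * (norm (fourier f \<xi>))\<^sup>2)"
    using integrable_Re[OF int] unfolding Ffg by simp
  have "(\<integral>\<^sup>+ \<xi>. ennreal (gauss m \<xi> * (norm (fourier f \<xi>))\<^sup>2) \<partial>lborel)
     = ennreal (LINT \<xi>|lborel. gauss m \<xi> * (norm (fourier f \<xi>))\<^sup>2)"
    using int' by (intro nn_integral_eq_integral) (auto simp: gauss_nonneg)
  also have "(LINT \<xi>|lborel. gauss m \<xi> * (norm (fourier f \<xi>))\<^sup>2)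
      = norm (LINT \<xi>|lborel. complex_of_real (gauss m \<xi> * (norm (fourier f \<xi>))\<^sup>2))"
    unfolding integral_complex_of_real
    by (simp add: integral_nonneg_AE gauss_nonneg)
  also have "\<dots> = norm (LINT \<xi>|lborel. fourier f \<xi> * g \<xi>)"
    by (simp only: Ffg)
  also have "\<dots> = norm (LINT x|lborel. f x * fourier g x)"
    by (simp add: integral_fourier_mult[OF f g])
  also have "ennreal \<dots> \<le> (\<integral>\<^sup>+ x. ennreal (norm (f x * fourier g x)) \<partial>lborel)"
    by (cases "integrable lborel (\<lambda>x. f x * fourier g x)")
       (auto intro: integral_norm_bound_ennreal simp: not_integrable_integral_eq)
  also have "\<dots> \<le> (\<integral>\<^sup>+ x. ennreal (norm (f x)) * (\<integral>\<^sup>+ y. ennreal (norm (f y) * gauss_kernel m (x - y)) \<partial>lborel) \<partial>lborel)"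
    by (intro nn_integral_mono) (auto simp: norm_mult ennreal_mult intro!: mult_left_mono Fg_le)
  also have "\<dots> \<le> (\<integral>\<^sup>+ x. ennreal ((norm (f x))\<^sup>2) \<partial>lborel)"
    by (intro gauss_kernel_form_le m) auto
  finally show ?thesis .
qed

text \<open>
  The Gaussians tend to one pointwise as \<open>m \<rightarrow> \<infinity>\<close>, so Fatou's lemma removes the weight.
\<close>

lemma plancherel_le:
  fixes f :: "real ^ 'n::finite \<Rightarrow> complex"
  assumes f: "integrable lborel f"
  shows "(\<integral>\<^sup>+ \<xi>. ennreal ((norm (fourier f \<xi>))\<^sup>2) \<partial>lborel)
    \<le> (\<integral>\<^sup>+ x. ennreal ((norm (f x))\<^sup>2) \<partial>lborel)"
proof -
  have [measurable]: "f \<in> borel_measurable borel"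
    using f by (auto dest: borel_measurable_integrable)
  let ?u = "\<lambda>k \<xi>. ennreal (gauss (real (Suc k)) \<xi> * (norm (fourier f \<xi>))\<^sup>2)"
  have lim: "(\<lambda>k. gauss (real (Suc k)) \<xi>) \<longlonglongrightarrow> 1" for \<xi> :: "real ^ 'n"
  proof -
    have "(\<lambda>k. exp (- ((\<xi> \<bullet> b) / real (Suc k))\<^sup>2 / 2)) \<longlonglongrightarrow> 1" for b
    proof -
      have "(\<lambda>k. (\<xi> \<bullet> b) / real (Suc k)) \<longlonglongrightarrow> 0"
        by (rule LIMSEQ_Suc[OF lim_const_over_n])
      then have "(\<lambda>k. exp (- ((\<xi> \<bullet> b) / real (Suc k))\<^sup>2 / 2)) \<longlonglongrightarrow> exp (- 0\<^sup>2 / 2)"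
        by (intro tendsto_intros) auto
      then show ?thesis by simp
    qed
    then have "(\<lambda>k. gauss (real (Suc k)) \<xi>) \<longlonglongrightarrow> (\<Prod>b\<in>(Basis::(real ^ 'n) set). 1)"
      unfolding gauss_def by (intro tendsto_prod)
    then show ?thesis by simp
  qed
  have "(\<integral>\<^sup>+ \<xi>. ennreal ((norm (fourier f \<xi>))\<^sup>2) \<partial>lborel) = (\<integral>\<^sup>+ \<xi>. liminf (\<lambda>k. ?u k \<xi>) \<partial>lborel)"
  proof (rule nn_integral_cong)
    fix \<xi>
    have "(\<lambda>k. ?u k \<xi>) \<longlonglongrightarrow> ennreal (1 * (norm (fourier f \<xi>))\<^sup>2)"
      by (intro tendsto_ennrealI tendsto_mult lim tendsto_const)
    then show "ennreal ((norm (fourier f \<xi>))\<^sup>2) = liminf (\<lambda>k. ?u k \<xi>)"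
      by (simp add: lim_imp_Liminf)
  qed
  also have "\<dots> \<le> liminf (\<lambda>k. \<integral>\<^sup>+ \<xi>. ?u k \<xi> \<partial>lborel)"
    by (intro nn_integral_liminf) measurable
  also have "\<dots> \<le> liminf (\<lambda>k. \<integral>\<^sup>+ x. ennreal ((norm (f x))\<^sup>2) \<partial>lborel)"
    by (intro Liminf_mono always_eventually allI fourier_gauss_weighted f) auto
  also have "\<dots> = (\<integral>\<^sup>+ x. ennreal ((norm (f x))\<^sup>2) \<partial>lborel)"
    by (simp add: Liminf_const)
  finally show ?thesis .
qed

section \<open>The Hausdorff-Young inequality\<close>

lemma nn_integral_powr_initial:
  fixes a s :: real
  assumes s: "s > 0" and a: "a \<ge> 0"
  shows "(\<integral>\<^sup>+ \<alpha>. ennreal (s * \<alpha> powr (s - 1)) * (if 0 \<le> \<alpha> \<and> \<alpha> \<le> a then 1 else 0) \<partial>lborel)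
    = ennreal (a powr s)"
proof -
  have "((\<lambda>\<alpha>. s * \<alpha> powr (s - 1)) has_integral s * (a powr (s - 1 + 1) / (s - 1 + 1))) {0..a}"
    using s a by (intro has_integral_mult_right has_integral_powr_from_0) auto
  then have "((\<lambda>\<alpha>. s * \<alpha> powr (s - 1)) has_integral a powr s) {0..a}"
    using s by simp
  from nn_integral_has_integral_lebesgue[OF _ this] s
  have "(\<integral>\<^sup>+ \<alpha>. ennreal (indicator {0..a} \<alpha> * (s * \<alpha> powr (s - 1))) \<partial>lborel) = ennreal (a powr s)"
    by auto
  also have "(\<lambda>\<alpha>. ennreal (indicator {0..a} \<alpha> * (s * \<alpha> powr (s - 1))))
     = (\<lambda>\<alpha>. ennreal (s * \<alpha> powr (s - 1)) * (if 0 \<le> \<alpha> \<and> \<alpha> \<le> a then 1 else 0))"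
    by (auto simp: fun_eq_iff)
  finally show ?thesis .
qed

lemma fourier_add:
  assumes "integrable lborel f" "integrable lborel g"
  shows "fourier (\<lambda>x. f x + g x) \<xi> = fourier f \<xi> + fourier g \<xi>"
proof -
  have "fourier (\<lambda>x. f x + g x) \<xi> =
     (LINT x|lborel. f x * cis (- (2 * pi * (x \<bullet> \<xi>))) + g x * cis (- (2 * pi * (x \<bullet> \<xi>))))"
    by (simp add: fourier_def distrib_right)
  also have "\<dots> = fourier f \<xi> + fourier g \<xi>"
    unfolding fourier_def
    by (intro Bochner_Integration.integral_add integrable_mult_cis assms) measurable
  finally show ?thesis .
qed

lemma fourier_cmult: "fourier (\<lambda>x. c * f x) \<xi> = c * fourier f \<xi>"
  by (simp add: fourier_def mult.assoc)

text \<open>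
  The height \<open>\<lambda>\<close> at which \<open>f\<close> is truncated for the level \<open>\<alpha>\<close> of its transform satisfies
  \<open>\<lambda>\<^bsup>1-u\<^esup> = \<alpha>/2\<close>.
\<close>

lemma truncation_level:
  fixes u \<alpha> :: real
  assumes "u > 1" "\<alpha> > 0"
  shows "((\<alpha> / 2) powr (- (1 / (u - 1)))) powr (1 - u) = \<alpha> / 2"
proof -
  have "- (1 / (u - 1)) * (1 - u) = 1" using assms by (simp add: field_simps)
  then show ?thesis using assms by (simp only: powr_powr powr_one)
qed

text \<open>
  Let \<open>\<lambda>\<close> be the truncation height. The part of \<open>f\<close> above \<open>\<lambda>\<close> has \<open>L\<^sup>1\<close> norm at most
  \<open>\<lambda>\<^bsup>1-u\<^esup> = \<alpha>/2\<close>, hence its transform never exceeds \<open>\<alpha>/2\<close>. Where the transform of \<open>f\<close> exceeds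
  \<open>\<alpha>\<close>, that of the part below \<open>\<lambda>\<close> must therefore exceed \<open>\<alpha>/2\<close>, and Chebyshev's and Plancherel's
  inequalities bound the measure of this set.
\<close>

lemma fourier_level_set:
  fixes f :: "real ^ 'n::finite \<Rightarrow> complex"
  assumes f: "integrable lborel f" and u: "u > 1"
    and nrm: "(\<integral>\<^sup>+ x. ennreal (norm (f x) powr u) \<partial>lborel) \<le> 1" and \<alpha>: "\<alpha> > 0"
  shows "(\<integral>\<^sup>+ \<xi>. (if 0 \<le> \<alpha> \<and> \<alpha> \<le> norm (fourier f \<xi>) then 1 else 0) \<partial>lborel)
    \<le> ennreal (4 / \<alpha>\<^sup>2) * (\<integral>\<^sup>+ x. ennreal ((norm (f x))\<^sup>2) *
         (if norm (f x) \<le> (\<alpha> / 2) powr (- (1 / (u - 1))) then 1 else 0) \<partial>lborel)"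
proof -
  have [measurable]: "f \<in> borel_measurable borel"
    using f by (auto dest: borel_measurable_integrable)
  define \<tau> where "\<tau> = (\<alpha> / 2) powr (- (1 / (u - 1)))"
  have \<tau>: "\<tau> > 0" using \<alpha> by (simp add: \<tau>_def)
  have \<tau>u: "\<tau> powr (1 - u) = \<alpha> / 2"
    unfolding \<tau>_def by (rule truncation_level[OF u \<alpha>])
  \<comment> \<open>The parts of \<open>f\<close> below and above the height \<open>\<tau>\<close>.\<close>
  define lo where "lo x = (if norm (f x) \<le> \<tau> then f x else 0)" for x
  define hi where "hi x = (if norm (f x) \<le> \<tau> then 0 else f x)" for x
  have [measurable]: "lo \<in> borel_measurable borel" "hi \<in> borel_measurable borel"
    unfolding lo_def[abs_def] hi_def[abs_def] by measurable
  have lo: "integrable lborel lo" and hi: "integrable lborel hi"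
    by (rule Bochner_Integration.integrable_bound[OF f]; auto simp: lo_def hi_def)+
  have "ennreal (LINT x|lborel. norm (hi x)) = (\<integral>\<^sup>+ x. ennreal (norm (hi x)) \<partial>lborel)"
    using hi by (subst nn_integral_eq_integral) auto
  also have "\<dots> \<le> (\<integral>\<^sup>+ x. ennreal (\<tau> powr (1 - u)) * ennreal (norm (f x) powr u) \<partial>lborel)"
  proof (intro nn_integral_mono)
    fix x
    show "ennreal (norm (hi x)) \<le> ennreal (\<tau> powr (1 - u)) * ennreal (norm (f x) powr u)"
    proof (cases "norm (f x) \<le> \<tau>")
      case False
      then have pos: "norm (f x) > 0" using \<tau> by linarith
      have "norm (f x) powr (1 - u) \<le> \<tau> powr (1 - u)"
        using False \<tau> u by (intro powr_mono2') auto
      then have "norm (f x) powr (1 - u) * norm (f x) powr u \<le> \<tau> powr (1 - u) * norm (f x) powr u"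
        by (intro mult_right_mono) auto
      then have "norm (f x) \<le> \<tau> powr (1 - u) * norm (f x) powr u"
        using pos by (simp add: powr_add[symmetric])
      then show ?thesis by (simp add: hi_def ennreal_mult[symmetric] ennreal_leI)
    qed (simp add: hi_def)
  qed
  also have "\<dots> = ennreal (\<tau> powr (1 - u)) * (\<integral>\<^sup>+ x. ennreal (norm (f x) powr u) \<partial>lborel)"
    by (intro nn_integral_cmult) measurable
  also have "\<dots> \<le> ennreal (\<tau> powr (1 - u)) * 1"
    by (intro mult_left_mono nrm) auto
  finally have hi_le: "(LINT x|lborel. norm (hi x)) \<le> \<alpha> / 2"
    using \<alpha> by (simp add: \<tau>u)
  have "(\<integral>\<^sup>+ \<xi>. (if 0 \<le> \<alpha> \<and> \<alpha> \<le> norm (fourier f \<xi>) then 1 else 0) \<partial>lborel)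
     \<le> (\<integral>\<^sup>+ \<xi>. ennreal (4 / \<alpha>\<^sup>2) * ennreal ((norm (fourier lo \<xi>))\<^sup>2) \<partial>lborel)"
  proof (intro nn_integral_mono)
    fix \<xi>
    have "(1::real) \<le> 4 / \<alpha>\<^sup>2 * (norm (fourier lo \<xi>))\<^sup>2" if "\<alpha> \<le> norm (fourier f \<xi>)"
    proof -
      have "f = (\<lambda>x. lo x + hi x)" by (auto simp: lo_def hi_def)
      then have "fourier f \<xi> = fourier lo \<xi> + fourier hi \<xi>"
        using fourier_add[OF lo hi, of \<xi>] by simp
      then have "norm (fourier f \<xi>) \<le> norm (fourier lo \<xi>) + norm (fourier hi \<xi>)"
        by (simp add: norm_triangle_ineq)
      with that hi_le norm_fourier_le[of hi \<xi>] have "\<alpha> / 2 \<le> norm (fourier lo \<xi>)" by linarith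
      then have "(\<alpha> / 2)\<^sup>2 \<le> (norm (fourier lo \<xi>))\<^sup>2"
        using \<alpha> by (intro power_mono) auto
      then show ?thesis using \<alpha> by (simp add: field_simps)
    qed
    then show "(if 0 \<le> \<alpha> \<and> \<alpha> \<le> norm (fourier f \<xi>) then 1 else 0)
       \<le> ennreal (4 / \<alpha>\<^sup>2) * ennreal ((norm (fourier lo \<xi>))\<^sup>2)"
      by (auto simp: ennreal_mult[symmetric] simp del: ennreal_1 simp flip: ennreal_1 intro!: ennreal_leI)
  qed
  also have "\<dots> = ennreal (4 / \<alpha>\<^sup>2) * (\<integral>\<^sup>+ \<xi>. ennreal ((norm (fourier lo \<xi>))\<^sup>2) \<partial>lborel)"
    by (intro nn_integral_cmult) measurable
  also have "\<dots> \<le> ennreal (4 / \<alpha>\<^sup>2) * (\<integral>\<^sup>+ x. ennreal ((norm (lo x))\<^sup>2) \<partial>lborel)"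
    by (intro mult_left_mono plancherel_le lo) auto
  also have "(\<integral>\<^sup>+ x. ennreal ((norm (lo x))\<^sup>2) \<partial>lborel) = (\<integral>\<^sup>+ x. ennreal ((norm (f x))\<^sup>2) *
         (if norm (f x) \<le> \<tau> then 1 else 0) \<partial>lborel)"
    by (intro nn_integral_cong) (auto simp: lo_def)
  finally show ?thesis by (simp add: \<tau>_def)
qed

text \<open>
  Marcinkiewicz interpolation. Writing \<open>|f\<^sup>^|\<^sup>v\<close> as an integral over levels \<open>\<alpha>\<close>, inserting the level set
  bound and integrating over \<open>\<alpha>\<close> first, the condition \<open>|f(x)| \<le> \<lambda>(\<alpha>)\<close> becomes
  \<open>\<alpha> \<le> 2 |f(x)|\<^bsup>1-u\<^esup>\<close>, and \<open>|f|\<^sup>2 |f|\<^bsup>(1-u)(v-2)\<^esup> = |f|\<^sup>u\<close>. Only the case of \<open>L\<^sup>u\<close> norm at most one has to be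
  considered, because the inequality is homogeneous.
\<close>

lemma hausdorff_young_normalized:
  fixes f :: "real ^ 'n::finite \<Rightarrow> complex"
  assumes f: "integrable lborel f" and u: "1 < u" "u < 2" and v: "v = u / (u - 1)"
    and nrm: "(\<integral>\<^sup>+ x. ennreal (norm (f x) powr u) \<partial>lborel) \<le> 1"
  shows "(\<integral>\<^sup>+ \<xi>. ennreal (norm (fourier f \<xi>) powr v) \<partial>lborel) \<le> ennreal (4 * v / (v - 2) * 2 powr (v - 2))"
proof -
  have [measurable]: "f \<in> borel_measurable borel"
    using f by (auto dest: borel_measurable_integrable)
  have v2: "v > 2" using u by (simp add: v field_simps)
  have uv: "(1 - u) * (v - 2) = u - 2" using u by (simp add: v field_simps)
  define \<tau> where "\<tau> \<alpha> = (\<alpha> / 2) powr (- (1 / (u - 1)))" for \<alpha> :: real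
  have [measurable]: "\<tau> \<in> borel_measurable borel" unfolding \<tau>_def[abs_def] by measurable
  let ?w = "\<lambda>\<alpha>. ennreal (v * \<alpha> powr (v - 1))"
  let ?E = "\<lambda>\<alpha> \<xi>. if 0 \<le> \<alpha> \<and> \<alpha> \<le> norm (fourier f \<xi>) then (1::ennreal) else 0"
  let ?S = "\<lambda>\<alpha> x. if norm (f x) \<le> \<tau> \<alpha> then (1::ennreal) else 0"
  let ?k = "\<lambda>\<alpha>. ennreal (if \<alpha> > 0 then 4 * v * \<alpha> powr (v - 2 - 1) else 0)"
  have "(\<integral>\<^sup>+ \<xi>. ennreal (norm (fourier f \<xi>) powr v) \<partial>lborel)
     = (\<integral>\<^sup>+ \<xi>. \<integral>\<^sup>+ \<alpha>. ?w \<alpha> * ?E \<alpha> \<xi> \<partial>lborel \<partial>lborel)"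
    using v2 by (subst nn_integral_powr_initial) auto
  also have "\<dots> = (\<integral>\<^sup>+ \<alpha>. \<integral>\<^sup>+ \<xi>. ?w \<alpha> * ?E \<alpha> \<xi> \<partial>lborel \<partial>lborel)"
    by (rule lborel_pair.Fubini') measurable
  also have "\<dots> = (\<integral>\<^sup>+ \<alpha>. ?w \<alpha> * (\<integral>\<^sup>+ \<xi>. ?E \<alpha> \<xi> \<partial>lborel) \<partial>lborel)"
    by (intro nn_integral_cong nn_integral_cmult) measurable
  also have "\<dots> \<le> (\<integral>\<^sup>+ \<alpha>. ?k \<alpha> * (\<integral>\<^sup>+ x. ennreal ((norm (f x))\<^sup>2) * ?S \<alpha> x \<partial>lborel) \<partial>lborel)"
  proof (intro nn_integral_mono)
    fix \<alpha> :: real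
    show "?w \<alpha> * (\<integral>\<^sup>+ \<xi>. ?E \<alpha> \<xi> \<partial>lborel) \<le> ?k \<alpha> * (\<integral>\<^sup>+ x. ennreal ((norm (f x))\<^sup>2) * ?S \<alpha> x \<partial>lborel)"
    proof (cases "\<alpha> > 0")
      case True
      have "?w \<alpha> * (\<integral>\<^sup>+ \<xi>. ?E \<alpha> \<xi> \<partial>lborel)
         \<le> ?w \<alpha> * (ennreal (4 / \<alpha>\<^sup>2) * (\<integral>\<^sup>+ x. ennreal ((norm (f x))\<^sup>2) * ?S \<alpha> x \<partial>lborel))"
        unfolding \<tau>_def using fourier_level_set[OF f u(1) nrm True] by (intro mult_left_mono) auto
      also have "\<dots> = (?w \<alpha> * ennreal (4 / \<alpha>\<^sup>2)) * (\<integral>\<^sup>+ x. ennreal ((norm (f x))\<^sup>2) * ?S \<alpha> x \<partial>lborel)"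
        by (simp only: mult.assoc)
      also have "?w \<alpha> * ennreal (4 / \<alpha>\<^sup>2) = ?k \<alpha>"
      proof -
        have "\<alpha> powr (v - 2 - 1) = \<alpha> powr (v - 1) / \<alpha> powr 2"
          by (simp add: powr_diff[symmetric])
        then show ?thesis using True v2
          by (simp add: ennreal_mult[symmetric] field_simps)
      qed
      finally show ?thesis .
    next
      case False
      then have "?w \<alpha> * ?E \<alpha> \<xi> = 0" for \<xi> by (cases "\<alpha> = 0") auto
      moreover have "?w \<alpha> * (\<integral>\<^sup>+ \<xi>. ?E \<alpha> \<xi> \<partial>lborel) = (\<integral>\<^sup>+ \<xi>. ?w \<alpha> * ?E \<alpha> \<xi> \<partial>lborel)"
        by (rule nn_integral_cmult[symmetric]) measurable
      ultimately have "?w \<alpha> * (\<integral>\<^sup>+ \<xi>. ?E \<alpha> \<xi> \<partial>lborel) = 0"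
        by (simp only: nn_integral_const) simp
      then show ?thesis by (simp only: zero_le)
    qed
  qed
  also have "\<dots> = (\<integral>\<^sup>+ \<alpha>. \<integral>\<^sup>+ x. ?k \<alpha> * (ennreal ((norm (f x))\<^sup>2) * ?S \<alpha> x) \<partial>lborel \<partial>lborel)"
    by (intro nn_integral_cong nn_integral_cmult[symmetric]) measurable
  also have "\<dots> = (\<integral>\<^sup>+ x. \<integral>\<^sup>+ \<alpha>. ?k \<alpha> * (ennreal ((norm (f x))\<^sup>2) * ?S \<alpha> x) \<partial>lborel \<partial>lborel)"
    by (rule lborel_pair.Fubini') measurable
  also have "\<dots> \<le> (\<integral>\<^sup>+ x. ennreal (4 * v / (v - 2) * 2 powr (v - 2)) * ennreal (norm (f x) powr u) \<partial>lborel)"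
  proof (intro nn_integral_mono)
    fix x
    define a where "a = 2 * norm (f x) powr (1 - u)"
    have a: "a \<ge> 0" by (simp add: a_def)
    show "(\<integral>\<^sup>+ \<alpha>. ?k \<alpha> * (ennreal ((norm (f x))\<^sup>2) * ?S \<alpha> x) \<partial>lborel)
       \<le> ennreal (4 * v / (v - 2) * 2 powr (v - 2)) * ennreal (norm (f x) powr u)"
    proof (cases "f x = 0")
      case False
      then have pos: "norm (f x) > 0" by simp
      have "(\<integral>\<^sup>+ \<alpha>. ?k \<alpha> * (ennreal ((norm (f x))\<^sup>2) * ?S \<alpha> x) \<partial>lborel)
         \<le> (\<integral>\<^sup>+ \<alpha>. ennreal (4 * v / (v - 2) * (norm (f x))\<^sup>2) *
             (ennreal ((v - 2) * \<alpha> powr (v - 2 - 1)) * (if 0 \<le> \<alpha> \<and> \<alpha> \<le> a then 1 else 0)) \<partial>lborel)"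
      proof (intro nn_integral_mono)
        fix \<alpha> :: real
        have le: "\<alpha> \<le> a" if "\<alpha> > 0" "norm (f x) \<le> \<tau> \<alpha>"
        proof -
          have "\<tau> \<alpha> powr (1 - u) \<le> norm (f x) powr (1 - u)"
            using that pos u by (intro powr_mono2') auto
          moreover have "\<tau> \<alpha> powr (1 - u) = \<alpha> / 2"
            unfolding \<tau>_def by (rule truncation_level[OF u(1) that(1)])
          ultimately show ?thesis by (simp add: a_def)
        qed
        show "?k \<alpha> * (ennreal ((norm (f x))\<^sup>2) * ?S \<alpha> x)
          \<le> ennreal (4 * v / (v - 2) * (norm (f x))\<^sup>2) *
             (ennreal ((v - 2) * \<alpha> powr (v - 2 - 1)) * (if 0 \<le> \<alpha> \<and> \<alpha> \<le> a then 1 else 0))"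
          using le v2 by (auto simp: ennreal_mult[symmetric])
      qed
      also have "\<dots> = ennreal (4 * v / (v - 2) * (norm (f x))\<^sup>2) * ennreal (a powr (v - 2))"
        using v2 a by (subst nn_integral_cmult, measurable) (subst nn_integral_powr_initial, auto)
      also have "\<dots> = ennreal (4 * v / (v - 2) * 2 powr (v - 2)) * ennreal (norm (f x) powr u)"
      proof -
        have "a powr (v - 2) = 2 powr (v - 2) * norm (f x) powr (u - 2)"
          using pos by (simp add: a_def powr_mult powr_powr uv)
        moreover have "(norm (f x))\<^sup>2 * norm (f x) powr (u - 2) = norm (f x) powr u"
          using pos by (simp add: powr_diff)
        ultimately show ?thesis using v2
          by (simp add: ennreal_mult[symmetric] mult_ac)
      qed
      finally show ?thesis .
    qed simp
  qed
  also have "\<dots> = ennreal (4 * v / (v - 2) * 2 powr (v - 2)) * (\<integral>\<^sup>+ x. ennreal (norm (f x) powr u) \<partial>lborel)"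
    by (intro nn_integral_cmult) measurable
  also have "\<dots> \<le> ennreal (4 * v / (v - 2) * 2 powr (v - 2)) * 1"
    by (intro mult_left_mono nrm) auto
  finally show ?thesis by simp
qed

text \<open>
  The end points \<open>\<theta> = 1\<close> and \<open>\<theta> = 1/2\<close> are treated separately, as the interpolation constant
  blows up at \<open>\<theta> = 1/2\<close> and the truncation height degenerates at \<open>\<theta> = 1\<close>.
\<close>

theorem hausdorff_young:
  assumes \<theta>: "1 / 2 \<le> \<theta>" "\<theta> \<le> 1"
  obtains C where "C > 0"
    "\<And>f :: real ^ 'n::finite \<Rightarrow> complex. integrable lborel f \<Longrightarrow> Lrec (1 - \<theta>) (fourier f) \<le> ennreal C * Lrec \<theta> f"
proof -
  consider "\<theta> = 1" | "\<theta> = 1 / 2" | "1 / 2 < \<theta>" "\<theta> < 1" using \<theta> by fastforce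
  then have "\<exists>C>0. \<forall>f :: real ^ 'n \<Rightarrow> complex. integrable lborel f \<longrightarrow> Lrec (1 - \<theta>) (fourier f) \<le> ennreal C * Lrec \<theta> f"
  proof cases
    case 1
    have "Lrec 0 (fourier f) \<le> ennreal 1 * Lrec 1 f" if f: "integrable lborel f" for f :: "real ^ 'n \<Rightarrow> complex"
    proof (rule ennreal_le_cmult_of_scale)
      have [measurable]: "f \<in> borel_measurable borel"
        using f by (auto dest: borel_measurable_integrable)
      fix B :: real assume B: "B > 0" "Lrec 1 f \<le> ennreal B"
      have "ennreal (LINT x|lborel. norm (f x)) = (\<integral>\<^sup>+ x. ennreal (norm (f x)) \<partial>lborel)"
        using f by (subst nn_integral_eq_integral) auto
      also have "\<dots> \<le> ennreal B" using B Lrec_pos_le_iff[of 1 B f] by simp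
      finally have "(LINT x|lborel. norm (f x)) \<le> B" using B by simp
      then have "norm (fourier f \<xi>) \<le> B" for \<xi> using norm_fourier_le[of f \<xi>] by linarith
      then show "Lrec 0 (fourier f) \<le> ennreal (1 * B)"
        using B Lrec_0_le_iff[of "fourier f" B] by simp
    qed simp
    then show ?thesis using 1 by (intro exI[of _ 1]) simp
  next
    case 2
    have "Lrec (1/2) (fourier f) \<le> ennreal 1 * Lrec (1/2) f" if f: "integrable lborel f" for f :: "real ^ 'n \<Rightarrow> complex"
    proof (rule ennreal_le_cmult_of_scale)
      fix B :: real assume B: "B > 0" "Lrec (1/2) f \<le> ennreal B"
      then have "(\<integral>\<^sup>+ x. ennreal ((norm (f x))\<^sup>2) \<partial>lborel) \<le> ennreal (B\<^sup>2)"
        using Lrec_pos_le_iff[of "1/2" B f] by simp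
      with plancherel_le[OF f] have "(\<integral>\<^sup>+ x. ennreal ((norm (fourier f x))\<^sup>2) \<partial>lborel) \<le> ennreal (B\<^sup>2)"
        by (rule order_trans)
      then show "Lrec (1/2) (fourier f) \<le> ennreal (1 * B)"
        using B Lrec_pos_le_iff[of "1/2" B "fourier f"] by simp
    qed simp
    moreover have "\<theta> = 1/2" "1 - \<theta> = 1/2" using 2 by auto
    ultimately show ?thesis by (metis zero_less_one)
  next
    case 3
    define u where "u = 1 / \<theta>"
    define v where "v = 1 / (1 - \<theta>)"
    have u: "1 < u" "u < 2" and v: "v = u / (u - 1)"
      using 3 by (simp_all add: u_def v_def field_simps)
    define K where "K = 4 * v / (v - 2) * 2 powr (v - 2)"
    have v2: "v > 2" using 3 by (simp add: v_def field_simps)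
    have K: "K > 0" using v2 by (simp add: K_def)
    define C where "C = K powr (1 - \<theta>)"
    have C: "C > 0" using K by (simp add: C_def)
    have CK: "C powr (1 / (1 - \<theta>)) = K" using K 3 by (simp add: C_def powr_powr)
    have "Lrec (1 - \<theta>) (fourier f) \<le> ennreal C * Lrec \<theta> f"
      if f: "integrable lborel f" for f :: "real ^ 'n \<Rightarrow> complex"
    proof (rule ennreal_le_cmult_of_scale[OF C])
      have [measurable]: "f \<in> borel_measurable borel"
        using f by (auto dest: borel_measurable_integrable)
      fix B :: real assume B: "B > 0" "Lrec \<theta> f \<le> ennreal B"
      \<comment> \<open>Normalisation: \<open>g\<close> has norm at most one.\<close>
      define g where "g x = complex_of_real (1 / B) * f x" for x
      have g: "integrable lborel g" unfolding g_def[abs_def] using f by (rule integrable_mult_right)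
      have [measurable]: "g \<in> borel_measurable borel" unfolding g_def[abs_def] by measurable
      have "Lrec \<theta> g \<le> ennreal (1 / B) * Lrec \<theta> f"
        using 3 B by (intro Lrec_mono) (auto simp: g_def norm_mult norm_divide)
      also have "\<dots> \<le> ennreal (1 / B) * ennreal B" using B by (intro mult_left_mono) auto
      also have "\<dots> = ennreal 1" using B by (simp add: ennreal_mult[symmetric])
      finally have "(\<integral>\<^sup>+ x. ennreal (norm (g x) powr u) \<partial>lborel) \<le> 1"
        using Lrec_pos_le_iff[of \<theta> 1 g] 3 by (simp add: u_def)
      from hausdorff_young_normalized[OF g u v this]
      have "Lrec (1 - \<theta>) (fourier g) \<le> ennreal C"
        using 3 K C CK Lrec_pos_le_iff[of "1 - \<theta>" C "fourier g"]
        by (simp only: K_def v_def)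
      moreover have "Lrec (1 - \<theta>) (fourier f) \<le> ennreal B * Lrec (1 - \<theta>) (fourier g)"
      proof (rule Lrec_mono)
        have "fourier g \<xi> = complex_of_real (1 / B) * fourier f \<xi>" for \<xi>
          unfolding g_def[abs_def] by (rule fourier_cmult)
        then show "AE \<xi> in lborel. norm (fourier f \<xi>) \<le> B * norm (fourier g \<xi>)"
          using B by (auto simp: norm_mult norm_divide)
      qed (use 3 B in auto)
      ultimately have "Lrec (1 - \<theta>) (fourier f) \<le> ennreal B * ennreal C"
        using mult_left_mono order_trans by (metis zero_le)
      then show "Lrec (1 - \<theta>) (fourier f) \<le> ennreal (C * B)"
        using B C by (simp add: ennreal_mult mult.commute)
    qed
    then show ?thesis using C by blast
  qed
  then show thesis using that by blast
qed

section \<open>Fourier transforms of derivatives of Schwartz functions\<close>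

text \<open>
  On the dyadic shell \<open>2\<^sup>m \<le> 1 + |x| < 2\<^bsup>m+1\<^esup>\<close> the integrand is at most \<open>2\<^bsup>-bm\<^esup>\<close>, and the shell lies in a ball
  of volume \<open>const 2\<^bsup>nm\<^esup>\<close>, so the integral is dominated by a geometric series of ratio \<open>2\<^bsup>n-b\<^esup>\<close>.
\<close>

lemma nn_integral_decay_finite:
  assumes b: "b > real DIM('a)"
  shows "(\<integral>\<^sup>+ x. ennreal ((1 + norm (x :: 'a::euclidean_space)) powr (- b)) \<partial>lborel) < \<infinity>"
proof -
  define n where "n = DIM('a)"
  define V where "V = unit_ball_vol (real n)"
  have V: "V \<ge> 0" by (simp add: V_def)
  \<comment> \<open>The ratio of the dominating geometric series.\<close>
  define \<rho> :: real where "\<rho> = 2 powr (real n - b)"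
  have \<rho>: "0 \<le> \<rho>" "\<rho> < 1" using b powr_less_mono[of "real n - b" 0 2] by (auto simp: \<rho>_def n_def)
  define u where "u m x = ennreal (2 powr (- b * real m)) * indicator (ball 0 (2 ^ Suc m)) x" for m and x :: 'a
  have u_borel: "u m \<in> borel_measurable lborel" for m
    unfolding u_def[abs_def] measurable_lborel2
    by (intro borel_measurable_times_ennreal borel_measurable_const borel_measurable_indicator) auto
  have "(\<integral>\<^sup>+ x. ennreal ((1 + norm (x :: 'a)) powr (- b)) \<partial>lborel) \<le> (\<integral>\<^sup>+ x. (\<Sum>m. u m x) \<partial>lborel)"
  proof (intro nn_integral_mono)
    fix x :: 'a
    have "\<exists>m. 1 + norm x < 2 ^ m" using real_arch_pow[of 2 "1 + norm x"] by auto
    then obtain m where m: "2 ^ m \<le> 1 + norm x" "1 + norm x < 2 ^ Suc m"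
      using exists_least_lemma[of "\<lambda>m. 1 + norm x < 2 ^ m"] by (auto simp: not_less)
    have "(1 + norm x) powr (- b) \<le> (2 ^ m) powr (- b)"
      using m b by (intro powr_mono2') auto
    also have "\<dots> = 2 powr (- b * real m)"
      by (simp add: powr_realpow[symmetric] powr_powr mult.commute)
    finally have "ennreal ((1 + norm x) powr (- b)) \<le> u m x"
      using m by (auto simp: u_def indicator_def intro!: ennreal_leI)
    also have "\<dots> \<le> (\<Sum>m. u m x)"
    proof -
      have "f m \<le> suminf f" for f :: "nat \<Rightarrow> ennreal"
        using sum_le_suminf[of f "{m}"] by simp
      then show ?thesis .
    qed
    finally show "ennreal ((1 + norm x) powr (- b)) \<le> (\<Sum>m. u m x)" .
  qed
  also have "\<dots> = (\<Sum>m. \<integral>\<^sup>+ x. u m x \<partial>lborel)"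
    by (rule nn_integral_suminf[OF u_borel])
  also have "\<dots> = (\<Sum>m. ennreal (V * 2 ^ n * \<rho> ^ m))"
  proof (intro suminf_cong)
    fix m
    have "(\<integral>\<^sup>+ x. u m x \<partial>lborel) = ennreal (2 powr (- b * real m)) * ennreal (V * (2 ^ Suc m) ^ n)"
      unfolding u_def by (subst nn_integral_cmult_indicator) (auto simp: emeasure_ball V_def n_def)
    also have "\<dots> = ennreal (2 powr (- b * real m) * (V * (2 ^ Suc m) ^ n))"
      using V by (simp add: ennreal_mult)
    also have "2 powr (- b * real m) * (V * (2 ^ Suc m) ^ n) = V * 2 ^ n * \<rho> ^ m"
    proof -
      have "\<rho> ^ m = 2 powr ((real n - b) * real m)"
        using powr_realpow[of \<rho> m] by (simp add: \<rho>_def powr_powr)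
      also have "(real n - b) * real m = - b * real m + real m * real n"
        by (simp add: algebra_simps)
      also have "2 powr \<dots> = 2 powr (- b * real m) * 2 powr (real m * real n)"
        by (rule powr_add)
      finally have "\<rho> ^ m = 2 powr (- b * real m) * 2 powr (real m * real n)" .
      moreover have "2 powr (real m * real n) = ((2::real) ^ m) ^ n"
        using powr_realpow[of 2 "m * n"] by (simp add: power_mult)
      ultimately show ?thesis by (simp add: power_mult_distrib)
    qed
    finally show "(\<integral>\<^sup>+ x. u m x \<partial>lborel) = ennreal (V * 2 ^ n * \<rho> ^ m)" .
  qed
  also have "\<dots> = ennreal (\<Sum>m. V * 2 ^ n * \<rho> ^ m)"
    using \<rho> V by (intro suminf_ennreal2 summable_mult summable_geometric) auto
  also have "\<dots> < \<infinity>" by simp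
  finally show ?thesis .
qed

lemma integrable_decay:
  assumes b: "b > real DIM('a)"
  shows "integrable lborel (\<lambda>x :: 'a::euclidean_space. (1 + norm x) powr (- b))"
  using nn_integral_decay_finite[where 'a='a, OF b] by (intro integrableI_nonneg) auto

lemma schwartz_partial_derivs:
  assumes "\<phi> \<in> schwartz" shows "partial_derivs is \<phi> \<in> schwartz"
proof -
  have "partial_derivs js (partial_derivs is \<phi>) = partial_derivs (js @ is) \<phi>" for js
    by (simp add: partial_derivs_def)
  then show ?thesis using assms unfolding schwartz_def by auto
qed

lemma schwartz_differentiable: "\<phi> \<in> schwartz \<Longrightarrow> \<phi> differentiable (at x)"
  unfolding schwartz_def differentiable_on_def
  by (auto dest!: spec[where x="[]"] simp: partial_derivs_def)

lemma schwartz_borel: "\<phi> \<in> schwartz \<Longrightarrow> \<phi> \<in> borel_measurable borel"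
  by (intro borel_measurable_continuous_onI)
     (simp add: continuous_at_imp_continuous_on differentiable_imp_continuous_within schwartz_differentiable)

lemma schwartz_decay:
  assumes "\<phi> \<in> schwartz"
  obtains C where "C > 0" "\<And>x. norm (\<phi> x) \<le> C * (1 + norm x) powr (- real N)"
proof -
  have b: "bounded (range (\<lambda>x. norm x ^ m *\<^sub>R \<phi> x))" for m
    using assms unfolding schwartz_def by (auto dest!: spec[where x="[]"] simp: partial_derivs_def)
  obtain A where A: "A > 0" "\<And>x. norm (\<phi> x) \<le> A"
    using b[of 0] unfolding bounded_pos by auto
  obtain B where B: "B > 0" "\<And>x. norm x ^ N * norm (\<phi> x) \<le> B"
    using b[of N] unfolding bounded_pos by auto
  have "norm (\<phi> x) \<le> 2 ^ N * (A + B) * (1 + norm x) powr (- real N)" for x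
  proof -
    have "(1 + norm x) ^ N \<le> 2 ^ N * (1 + norm x ^ N)"
    proof (cases "norm x \<le> 1")
      case True
      then have "(1 + norm x) ^ N \<le> 2 ^ N" by (intro power_mono) auto
      also have "\<dots> \<le> 2 ^ N * (1 + norm x ^ N)" by simp
      finally show ?thesis .
    next
      case False
      then have "(1 + norm x) ^ N \<le> (2 * norm x) ^ N" by (intro power_mono) auto
      also have "\<dots> \<le> 2 ^ N * (1 + norm x ^ N)" by (simp add: power_mult_distrib)
      finally show ?thesis .
    qed
    then have "(1 + norm x) ^ N * norm (\<phi> x) \<le> 2 ^ N * (1 + norm x ^ N) * norm (\<phi> x)"
      by (intro mult_right_mono) auto
    also have "\<dots> = 2 ^ N * (norm (\<phi> x) + norm x ^ N * norm (\<phi> x))" by (simp add: algebra_simps)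
    also have "\<dots> \<le> 2 ^ N * (A + B)" using A B by (intro mult_left_mono add_mono) auto
    finally have *: "(1 + norm x) ^ N * norm (\<phi> x) \<le> 2 ^ N * (A + B)" .
    have "1 + norm x > 0" by (simp add: add_pos_nonneg)
    then show ?thesis using * by (simp add: powr_minus powr_realpow field_simps)
  qed
  then show thesis using A B by (intro that[of "2 ^ N * (A + B)"]) auto
qed

lemma schwartz_integrable:
  fixes \<phi> :: "real ^ 'n::finite \<Rightarrow> complex"
  assumes "\<phi> \<in> schwartz" shows "integrable lborel \<phi>"
proof -
  obtain C where C: "C > 0" "\<And>x. norm (\<phi> x) \<le> C * (1 + norm x) powr (- real (Suc (CARD('n))))"
    using schwartz_decay[OF assms] by metis
  show ?thesis
  proof (rule Bochner_Integration.integrable_bound)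
    show "integrable lborel (\<lambda>x :: real ^ 'n. C * (1 + norm x) powr (- real (Suc (CARD('n)))))"
      by (intro integrable_mult_right integrable_decay) simp
    show "AE x in lborel. norm (\<phi> x) \<le> norm (C * (1 + norm x) powr (- real (Suc (CARD('n)))))"
      using C by (auto intro!: AE_I2 order_trans[OF C(2)])
    show "\<phi> \<in> borel_measurable lborel" using schwartz_borel[OF assms] by simp
  qed
qed

lemma schwartz_line_derivative:
  fixes \<phi> :: "real ^ 'n::finite \<Rightarrow> complex"
  assumes "\<phi> \<in> schwartz"
  shows "((\<lambda>s. \<phi> (x + s *\<^sub>R axis i 1)) has_vector_derivative partial_deriv i \<phi> (x + s *\<^sub>R axis i 1)) (at s)"
proof -
  have "(\<lambda>h. \<phi> ((x + s *\<^sub>R axis i 1) + h *\<^sub>R axis i 1)) differentiable (at 0)"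
    using differentiable_chain_at[of "\<lambda>h. (x + s *\<^sub>R axis i 1) + h *\<^sub>R axis i 1" "0::real" \<phi>]
      schwartz_differentiable[OF assms] by (simp add: o_def)
  then have "((\<lambda>h. \<phi> ((x + s *\<^sub>R axis i 1) + h *\<^sub>R axis i 1))
      has_vector_derivative partial_deriv i \<phi> (x + s *\<^sub>R axis i 1)) (at (s - s))"
    unfolding partial_deriv_def by (simp add: vector_derivative_works)
  moreover have "((\<lambda>r. r - s) has_vector_derivative 1) (at s)"
    by (auto intro!: derivative_eq_intros)
  ultimately have "((\<lambda>h. \<phi> ((x + s *\<^sub>R axis i 1) + h *\<^sub>R axis i 1)) \<circ> (\<lambda>r. r - s)
      has_vector_derivative 1 *\<^sub>R partial_deriv i \<phi> (x + s *\<^sub>R axis i 1)) (at s)"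
    by (rule vector_diff_chain_at[rotated])
  then show ?thesis by (simp add: o_def algebra_simps)
qed

lemma has_vector_derivative_difference_quotient:
  fixes f :: "real \<Rightarrow> 'b::real_normed_vector"
  assumes "(f has_vector_derivative D) (at 0)"
  shows "(\<lambda>m. (f (1 / real (Suc m)) - f 0) /\<^sub>R (1 / real (Suc m))) \<longlonglongrightarrow> D"
proof -
  have "((\<lambda>y. norm ((f y - f 0) - (y - 0) *\<^sub>R D) / norm (y - 0)) \<longlongrightarrow> 0) (at 0)"
    using assms unfolding has_vector_derivative_def has_derivative_iff_norm by blast
  moreover have "filterlim (\<lambda>m. 1 / real (Suc m)) (at 0) sequentially"
    using LIMSEQ_Suc[OF lim_1_over_n] by (auto simp: filterlim_at)
  ultimately have "(\<lambda>m. norm ((f (1 / real (Suc m)) - f 0) - (1 / real (Suc m) - 0) *\<^sub>R D) / norm (1 / real (Suc m) - 0)) \<longlonglongrightarrow> 0"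
    by (rule filterlim_compose)
  moreover have "norm ((f h - f 0) - (h - 0) *\<^sub>R D) / norm (h - 0) = norm ((f h - f 0) /\<^sub>R h - D)"
    if "h > 0" for h :: real
  proof -
    have "(f h - f 0) /\<^sub>R h - D = ((f h - f 0) - h *\<^sub>R D) /\<^sub>R h"
      using that by (simp add: scaleR_diff_right)
    then show ?thesis using that by (simp add: divide_inverse mult.commute)
  qed
  moreover have "1 / real (Suc m) > 0" for m by simp
  ultimately have "(\<lambda>m. norm ((f (1 / real (Suc m)) - f 0) /\<^sub>R (1 / real (Suc m)) - D)) \<longlonglongrightarrow> 0"
    by (simp only:)
  then show ?thesis by (simp add: tendsto_norm_zero_iff LIM_zero_iff)
qed

lemma fourier_translate:
  fixes f :: "real ^ 'n::finite \<Rightarrow> complex"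
  assumes [measurable]: "f \<in> borel_measurable borel"
  shows "fourier (\<lambda>x. f (x + a)) \<xi> = cis (2 * pi * (a \<bullet> \<xi>)) * fourier f \<xi>"
proof -
  have "fourier f \<xi> = (LINT x|distr lborel borel ((+) a). f x * cis (- (2 * pi * (x \<bullet> \<xi>))))"
    by (simp add: fourier_def lborel_distr_plus)
  also have "\<dots> = (LINT x|lborel. f (x + a) * cis (- (2 * pi * ((x + a) \<bullet> \<xi>))))"
    by (subst integral_distr) (simp_all add: add.commute)
  also have "(\<lambda>x. f (x + a) * cis (- (2 * pi * ((x + a) \<bullet> \<xi>))))
     = (\<lambda>x. cis (- (2 * pi * (a \<bullet> \<xi>))) * (f (x + a) * cis (- (2 * pi * (x \<bullet> \<xi>)))))"
  proof
    fix x
    have "cis (- (2 * pi * ((x + a) \<bullet> \<xi>))) = cis (- (2 * pi * (a \<bullet> \<xi>))) * cis (- (2 * pi * (x \<bullet> \<xi>)))"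
      by (simp add: cis_mult inner_add_left algebra_simps)
    then show "f (x + a) * cis (- (2 * pi * ((x + a) \<bullet> \<xi>)))
        = cis (- (2 * pi * (a \<bullet> \<xi>))) * (f (x + a) * cis (- (2 * pi * (x \<bullet> \<xi>))))"
      by simp
  qed
  also have "(LINT x|lborel. cis (- (2 * pi * (a \<bullet> \<xi>))) * (f (x + a) * cis (- (2 * pi * (x \<bullet> \<xi>)))))
     = cis (- (2 * pi * (a \<bullet> \<xi>))) * fourier (\<lambda>x. f (x + a)) \<xi>"
    unfolding fourier_def by (rule integral_mult_right_zero)
  finally have "cis (2 * pi * (a \<bullet> \<xi>)) * fourier f \<xi>
    = cis (2 * pi * (a \<bullet> \<xi>)) * cis (- (2 * pi * (a \<bullet> \<xi>))) * fourier (\<lambda>x. f (x + a)) \<xi>"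
    by (simp add: mult.assoc)
  then show ?thesis by (simp add: cis_mult)
qed

text \<open>
  The transform of a difference quotient of \<open>\<phi>\<close> is \<open>(e\<^bsup>2\<pi>ih\<xi>\<^sub>i\<^esup> - 1) / h\<close> times the transform of
  \<open>\<phi>\<close>, because translation becomes modulation. Dominated convergence as \<open>h \<rightarrow> 0\<close> avoids an integration by parts in
  a single coordinate.
\<close>

lemma fourier_partial_deriv:
  fixes \<phi> :: "real ^ 'n::finite \<Rightarrow> complex"
  assumes \<phi>: "\<phi> \<in> schwartz"
  shows "fourier (partial_deriv i \<phi>) \<xi> = complex_of_real (2 * pi * \<xi> $ i) * \<i> * fourier \<phi> \<xi>"
proof -
  define e :: "real ^ 'n" where "e = axis i 1"
  define h where "h m = 1 / real (Suc m)" for m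
  have h: "0 < h m" "h m \<le> 1" for m by (simp_all add: h_def)
  \<comment> \<open>One more than the dimension, so that decay of order \<open>N\<close> is integrable.\<close>
  define N where "N = Suc (CARD('n))"
  have d\<phi>: "partial_deriv i \<phi> \<in> schwartz"
    using schwartz_partial_derivs[OF \<phi>, of "[i]"] by (simp add: partial_derivs_def)
  note [measurable] = schwartz_borel[OF \<phi>] schwartz_borel[OF d\<phi>]
  obtain C where C: "C > 0" "\<And>x. norm (partial_deriv i \<phi> x) \<le> C * (1 + norm x) powr (- real N)"
    using schwartz_decay[OF d\<phi>] by metis
  let ?q = "\<lambda>m x. (\<phi> (x + h m *\<^sub>R e) - \<phi> x) /\<^sub>R h m * cis (- (2 * pi * (x \<bullet> \<xi>)))"
  have lim1: "(\<lambda>m. LINT x|lborel. ?q m x) \<longlonglongrightarrow> fourier (partial_deriv i \<phi>) \<xi>"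
    unfolding fourier_def
  proof (rule integral_dominated_convergence)
    show "integrable lborel (\<lambda>x :: real ^ 'n. C * 2 ^ N * (1 + norm x) powr (- real N))"
      by (intro integrable_mult_right integrable_decay) (simp add: N_def)
    show "AE x in lborel. (\<lambda>m. ?q m x) \<longlonglongrightarrow> partial_deriv i \<phi> x * cis (- (2 * pi * (x \<bullet> \<xi>)))"
    proof (intro AE_I2 tendsto_mult tendsto_const)
      fix x
      have "((\<lambda>s. \<phi> (x + s *\<^sub>R e)) has_vector_derivative partial_deriv i \<phi> x) (at 0)"
        using schwartz_line_derivative[OF \<phi>, of x i 0] by (simp add: e_def)
      from has_vector_derivative_difference_quotient[OF this]
      show "(\<lambda>m. (\<phi> (x + h m *\<^sub>R e) - \<phi> x) /\<^sub>R h m) \<longlonglongrightarrow> partial_deriv i \<phi> x"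
        by (simp add: h_def)
    qed
    fix m
    show "AE x in lborel. norm (?q m x) \<le> C * 2 ^ N * (1 + norm x) powr (- real N)"
    proof (rule AE_I2)
      fix x
      have der: "((\<lambda>s. \<phi> (x + s *\<^sub>R e)) has_derivative (\<lambda>r. r *\<^sub>R partial_deriv i \<phi> (x + s *\<^sub>R e))) (at s)" for s
        using schwartz_line_derivative[OF \<phi>, of x i s] by (simp add: e_def has_vector_derivative_def)
      \<comment> \<open>The mean value inequality bounds the quotient by a derivative at distance at most one from \<open>x\<close>.\<close>
      have "\<exists>s\<in>{0<..<h m}. norm (\<phi> (x + h m *\<^sub>R e) - \<phi> (x + 0 *\<^sub>R e))
          \<le> norm ((h m - 0) *\<^sub>R partial_deriv i \<phi> (x + s *\<^sub>R e))"
        using h der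
        by (intro mvt_general) (auto intro!: continuous_at_imp_continuous_on has_derivative_continuous)
      then obtain s where s: "0 < s" "s < h m"
          "norm (\<phi> (x + h m *\<^sub>R e) - \<phi> x) \<le> h m * norm (partial_deriv i \<phi> (x + s *\<^sub>R e))"
        using h[of m] by auto
      have "norm (?q m x) = norm (\<phi> (x + h m *\<^sub>R e) - \<phi> x) / h m"
        using h[of m] by (simp add: norm_mult divide_inverse mult.commute)
      also have "\<dots> \<le> norm (partial_deriv i \<phi> (x + s *\<^sub>R e))"
        using s h[of m] by (simp add: divide_le_eq mult.commute)
      also have "\<dots> \<le> C * (1 + norm (x + s *\<^sub>R e)) powr (- real N)"
        by (rule C)
      also have "(1 + norm (x + s *\<^sub>R e)) powr (- real N) \<le> ((1 + norm x) / 2) powr (- real N)"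
      proof (rule powr_mono2')
        have "norm x \<le> norm (x + s *\<^sub>R e) + norm (s *\<^sub>R e)"
          using norm_triangle_ineq4[of "x + s *\<^sub>R e" "s *\<^sub>R e"] by simp
        moreover have "norm (s *\<^sub>R e) \<le> 1"
          using s h[of m] by (simp add: e_def)
        ultimately have "norm x \<le> norm (x + s *\<^sub>R e) + 1" by linarith
        then show "(1 + norm x) / 2 \<le> 1 + norm (x + s *\<^sub>R e)"
          using norm_ge_zero[of "x + s *\<^sub>R e"] by argo
        show "0 < (1 + norm x) / 2" using norm_ge_zero[of x] by argo
      qed simp
      also have "((1 + norm x) / 2) powr (- real N) = 2 ^ N * (1 + norm x) powr (- real N)"
        by (simp add: powr_divide powr_minus powr_realpow field_simps)
      finally show "norm (?q m x) \<le> C * 2 ^ N * (1 + norm x) powr (- real N)"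
        using C(1) by (simp add: mult.assoc)
    qed
  qed measurable
  define g where "g s = cis (2 * pi * (s * \<xi> $ i)) * fourier \<phi> \<xi>" for s
  have q: "(LINT x|lborel. ?q m x) = (g (h m) - g 0) /\<^sub>R h m" for m
  proof -
    have sh: "integrable lborel (\<lambda>x. \<phi> (x + h m *\<^sub>R e))"
    proof -
      have "integrable (distr lborel borel ((+) (h m *\<^sub>R e))) \<phi>"
        by (simp add: lborel_distr_plus schwartz_integrable[OF \<phi>])
      then show ?thesis by (subst (asm) integrable_distr_eq) (auto simp: add.commute)
    qed
    have "(LINT x|lborel. ?q m x) = (LINT x|lborel. (\<phi> (x + h m *\<^sub>R e) * cis (- (2 * pi * (x \<bullet> \<xi>)))
        - \<phi> x * cis (- (2 * pi * (x \<bullet> \<xi>)))) /\<^sub>R h m)"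
      by (simp add: left_diff_distrib)
    also have "\<dots> = (LINT x|lborel. (\<phi> (x + h m *\<^sub>R e) * cis (- (2 * pi * (x \<bullet> \<xi>)))
        - \<phi> x * cis (- (2 * pi * (x \<bullet> \<xi>))))) /\<^sub>R h m"
      by (rule integral_scaleR_right)
    also have "(LINT x|lborel. (\<phi> (x + h m *\<^sub>R e) * cis (- (2 * pi * (x \<bullet> \<xi>)))
        - \<phi> x * cis (- (2 * pi * (x \<bullet> \<xi>))))) = fourier (\<lambda>x. \<phi> (x + h m *\<^sub>R e)) \<xi> - fourier \<phi> \<xi>"
      unfolding fourier_def
      by (intro Bochner_Integration.integral_diff integrable_mult_cis sh schwartz_integrable[OF \<phi>]) measurable
    also have "fourier (\<lambda>x. \<phi> (x + h m *\<^sub>R e)) \<xi> = g (h m)"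
      by (subst fourier_translate) (simp_all add: g_def e_def inner_commute[of _ \<xi>] inner_axis)
    also have "fourier \<phi> \<xi> = g 0" by (simp add: g_def)
    finally show ?thesis .
  qed
  have "(g has_vector_derivative (complex_of_real (2 * pi * \<xi> $ i) * \<i> * fourier \<phi> \<xi>)) (at 0)"
  proof -
    have "((\<lambda>z. exp (\<i> * (complex_of_real (2 * pi * \<xi> $ i) * z)) * fourier \<phi> \<xi>)
       has_field_derivative complex_of_real (2 * pi * \<xi> $ i) * \<i> * fourier \<phi> \<xi>) (at (complex_of_real 0))"
      by (auto intro!: derivative_eq_intros)
    from has_vector_derivative_real_field[OF this]
    show ?thesis unfolding g_def[abs_def] cis_conv_exp by (simp add: mult_ac)
  qed
  from has_vector_derivative_difference_quotient[OF this]
  have "(\<lambda>m. LINT x|lborel. ?q m x) \<longlonglongrightarrow> complex_of_real (2 * pi * \<xi> $ i) * \<i> * fourier \<phi> \<xi>"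
    unfolding q by (simp only: h_def)
  with lim1 show ?thesis by (rule LIMSEQ_unique)
qed

lemma fourier_pure_derivative:
  fixes \<phi> :: "real ^ 'n::finite \<Rightarrow> complex"
  assumes \<phi>: "\<phi> \<in> schwartz"
  shows "fourier (partial_derivs (replicate j i) \<phi>) \<xi> = (complex_of_real (2 * pi * \<xi> $ i) * \<i>) ^ j * fourier \<phi> \<xi>"
proof (induction j)
  case (Suc j)
  have "partial_derivs (replicate (Suc j) i) \<phi> = partial_deriv i (partial_derivs (replicate j i) \<phi>)"
    by (simp add: partial_derivs_def)
  then show ?case
    using fourier_partial_deriv[OF schwartz_partial_derivs[OF \<phi>, of "replicate j i"], of i \<xi>] Suc
    by (simp add: mult_ac)
qed (simp add: partial_derivs_def)

lemma exists_large_component: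
  fixes \<xi> :: "real ^ 'n::finite"
  shows "\<exists>i. norm \<xi> \<le> real CARD('n) * \<bar>\<xi> $ i\<bar>"
proof (rule ccontr)
  assume "\<not> ?thesis"
  then have "(\<Sum>i\<in>(UNIV::'n set). real CARD('n) * \<bar>\<xi> $ i\<bar>) < (\<Sum>i\<in>(UNIV::'n set). norm \<xi>)"
    by (intro sum_strict_mono) (auto simp: not_le)
  then have "(\<Sum>i\<in>(UNIV::'n set). \<bar>\<xi> $ i\<bar>) < norm \<xi>"
    by (simp add: sum_distrib_left[symmetric])
  then show False using norm_le_l1_cart[of \<xi>] by linarith
qed

lemma derivs_length_borel:
  fixes \<phi> :: "real ^ 'n::finite \<Rightarrow> complex"
  assumes "\<phi> \<in> schwartz" shows "derivs_length j \<phi> \<in> borel_measurable borel"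
proof -
  have [measurable]: "partial_derivs is \<phi> \<in> borel_measurable borel" for "is"
    by (intro schwartz_borel schwartz_partial_derivs assms)
  show ?thesis unfolding derivs_length_def[abs_def] by measurable
qed

lemma norm_pure_derivative_le:
  fixes \<phi> :: "real ^ 'n::finite \<Rightarrow> complex"
  shows "norm (partial_derivs (replicate j i) \<phi> x) \<le> derivs_length j \<phi> x"
proof -
  have "finite {is :: 'n list. length is = j}"
    using finite_lists_length_eq[of "UNIV :: 'n set" j] by simp
  then show ?thesis unfolding derivs_length_def
    by (intro real_le_rsqrt member_le_sum[where f="\<lambda>is. (norm (partial_derivs is \<phi> x))\<^sup>2"]) auto
qed

text \<open>
  If \<open>|\<xi>| \<le> n |\<xi>\<^sub>i|\<close>, then \<open>|\<xi>|\<^sup>j |\<phi>\<^sup>^(\<xi>)|\<close> is at most \<open>n\<^sup>j\<close> times the modulus of the transform of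
  \<open>\<partial>\<^sub>i\<^sup>j \<phi>\<close> at \<open>\<xi>\<close>. Thus the pure derivatives suffice.
\<close>

lemma hausdorff_young_derivatives:
  assumes \<theta>: "1 / 2 \<le> \<theta>" "\<theta> \<le> 1"
  obtains C where "C > 0" "\<And>\<phi> :: real ^ 'n::finite \<Rightarrow> complex. \<phi> \<in> schwartz \<Longrightarrow>
      Lrec (1 - \<theta>) (\<lambda>\<xi>. norm \<xi> ^ j * norm (fourier \<phi> \<xi>)) \<le> ennreal C * Lrec \<theta> (derivs_length j \<phi>)"
proof -
  obtain C where C: "C > 0"
    "\<And>f :: real ^ 'n \<Rightarrow> complex. integrable lborel f \<Longrightarrow> Lrec (1 - \<theta>) (fourier f) \<le> ennreal C * Lrec \<theta> f"
    using hausdorff_young[OF \<theta>] by metis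
  define n where "n = real CARD('n)"
  have n: "n \<ge> 1" by (simp add: n_def Suc_le_eq)
  define K where "K = n * (n ^ j * C)"
  have K: "K > 0" using n C by (simp add: K_def)
  have "Lrec (1 - \<theta>) (\<lambda>\<xi>. norm \<xi> ^ j * norm (fourier \<phi> \<xi>)) \<le> ennreal K * Lrec \<theta> (derivs_length j \<phi>)"
    if \<phi>: "\<phi> \<in> schwartz" for \<phi> :: "real ^ 'n \<Rightarrow> complex"
  proof -
    define \<psi> where "\<psi> i = partial_derivs (replicate j i) \<phi>" for i
    have \<psi>: "\<psi> i \<in> schwartz" for i unfolding \<psi>_def by (intro schwartz_partial_derivs \<phi>)
    note [measurable] = schwartz_borel[OF \<phi>] schwartz_borel[OF \<psi>] derivs_length_borel[OF \<phi>]
    have "Lrec (1 - \<theta>) (\<lambda>\<xi>. norm \<xi> ^ j * norm (fourier \<phi> \<xi>))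
       \<le> (\<Sum>i\<in>UNIV. Lrec (1 - \<theta>) (\<lambda>\<xi>. complex_of_real (n ^ j) * fourier (\<psi> i) \<xi>))"
    proof (rule Lrec_le_sum_of_cover)
      show "AE \<xi> in lborel. \<exists>i\<in>UNIV. norm (norm \<xi> ^ j * norm (fourier \<phi> \<xi>))
          \<le> norm (complex_of_real (n ^ j) * fourier (\<psi> i) \<xi>)"
      proof (rule AE_I2)
        fix \<xi> :: "real ^ 'n"
        obtain i where i: "norm \<xi> \<le> n * \<bar>\<xi> $ i\<bar>"
          using exists_large_component[of \<xi>] by (auto simp: n_def)
        have "\<bar>\<xi> $ i\<bar> \<le> 2 * pi * \<bar>\<xi> $ i\<bar>"
          using mult_right_mono[of 1 "2 * pi" "\<bar>\<xi> $ i\<bar>"] pi_gt3 by simp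
        then have "n * \<bar>\<xi> $ i\<bar> \<le> n * (2 * pi * \<bar>\<xi> $ i\<bar>)"
          using n by (intro mult_left_mono) auto
        with i have "norm \<xi> \<le> n * (2 * pi * \<bar>\<xi> $ i\<bar>)" by linarith
        then have "norm \<xi> ^ j \<le> (n * (2 * pi * \<bar>\<xi> $ i\<bar>)) ^ j"
          by (intro power_mono) auto
        then have "norm \<xi> ^ j * norm (fourier \<phi> \<xi>) \<le> (n * (2 * pi * \<bar>\<xi> $ i\<bar>)) ^ j * norm (fourier \<phi> \<xi>)"
          by (intro mult_right_mono) auto
        also have "\<dots> = norm (complex_of_real (n ^ j) * fourier (\<psi> i) \<xi>)"
          using n by (simp add: \<psi>_def fourier_pure_derivative[OF \<phi>] norm_mult norm_power power_mult_distrib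
              abs_mult mult.assoc)
        finally show "\<exists>i\<in>UNIV. norm (norm \<xi> ^ j * norm (fourier \<phi> \<xi>))
          \<le> norm (complex_of_real (n ^ j) * fourier (\<psi> i) \<xi>)" by auto
      qed
    qed (use \<theta> in auto)
    also have "\<dots> \<le> (\<Sum>i\<in>(UNIV::'n set). ennreal (n ^ j) * (ennreal C * Lrec \<theta> (derivs_length j \<phi>)))"
    proof (rule sum_mono)
      fix i :: 'n
      have "Lrec (1 - \<theta>) (\<lambda>\<xi>. complex_of_real (n ^ j) * fourier (\<psi> i) \<xi>)
         \<le> ennreal (n ^ j) * Lrec (1 - \<theta>) (fourier (\<psi> i))"
        using \<theta> n by (intro Lrec_mono) (auto simp: norm_mult norm_power)
      also have "Lrec (1 - \<theta>) (fourier (\<psi> i)) \<le> ennreal C * Lrec \<theta> (\<psi> i)"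
        by (intro C schwartz_integrable \<psi>)
      also have "Lrec \<theta> (\<psi> i) \<le> ennreal 1 * Lrec \<theta> (derivs_length j \<phi>)"
        using \<theta> norm_pure_derivative_le[of j i \<phi>]
        by (intro Lrec_mono) (auto simp: \<psi>_def[symmetric] intro: order_trans[OF _ abs_ge_self])
      finally show "Lrec (1 - \<theta>) (\<lambda>\<xi>. complex_of_real (n ^ j) * fourier (\<psi> i) \<xi>)
         \<le> ennreal (n ^ j) * (ennreal C * Lrec \<theta> (derivs_length j \<phi>))"
        by (simp add: mult_left_mono)
    qed
    also have "\<dots> = ennreal n * (ennreal (n ^ j) * (ennreal C * Lrec \<theta> (derivs_length j \<phi>)))"
      by (simp add: n_def ennreal_of_nat_eq_real_of_nat)
    also have "\<dots> = ennreal K * Lrec \<theta> (derivs_length j \<phi>)"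
      using n C by (simp add: K_def ennreal_mult mult.assoc)
    finally show ?thesis .
  qed
  then show thesis using K that by blast
qed

section \<open>Radial multipliers\<close>

text \<open>
  Negative \<open>a\<close> and \<open>\<sigma>\<close> are allowed, so that low frequencies (\<open>\<sigma> = \<sigma>\<^sub>1\<close>) and high frequencies
  (\<open>\<sigma> = -\<sigma>\<^sub>2\<close>) are covered by the same scaling argument. At the origin the value is \<open>0\<close>, even for \<open>a = 0\<close>,
  because \<open>0 powr a = 0\<close>; this affects a null set only.
\<close>

definition radial_multiplier :: "real \<Rightarrow> real \<Rightarrow> real \<Rightarrow> 'a::euclidean_space \<Rightarrow> real" where
  "radial_multiplier a c \<sigma> \<xi> = norm \<xi> powr a * exp (- c * norm \<xi> powr \<sigma>)"

lemma radial_multiplier_borel[measurable]: "radial_multiplier a c \<sigma> \<in> borel_measurable borel"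
  unfolding radial_multiplier_def[abs_def] by measurable

lemma radial_multiplier_nonneg: "radial_multiplier a c \<sigma> \<xi> \<ge> 0"
  by (simp add: radial_multiplier_def)

lemma powr_exp_bounded:
  fixes b c :: real
  assumes b: "b \<ge> 0" and c: "c > 0"
  obtains M where "M > 0" "\<And>y. y \<ge> 0 \<Longrightarrow> y powr b * exp (- c * y) \<le> M"
proof -
  have "((\<lambda>y. y powr b * exp (- c * y)) \<longlongrightarrow> 0) at_top"
    using b c by real_asymp
  then have "eventually (\<lambda>y. y powr b * exp (- c * y) < 1) at_top"
    by (rule order_tendstoD) simp
  then obtain Y where Y: "\<And>y. y \<ge> Y \<Longrightarrow> y powr b * exp (- c * y) < 1"
    unfolding eventually_at_top_linorder by auto
  have "y powr b * exp (- c * y) \<le> 1 + \<bar>Y\<bar> powr b" if y: "y \<ge> 0" for y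
  proof (cases "y \<ge> Y")
    case True
    then show ?thesis using Y[of y] powr_ge_zero[of "\<bar>Y\<bar>" b] by linarith
  next
    case False
    have "y powr b * exp (- c * y) \<le> y powr b * 1"
      using c y by (intro mult_left_mono) auto
    also have "\<dots> \<le> \<bar>Y\<bar> powr b" using False y b by (simp add: powr_mono2)
    finally show ?thesis by simp
  qed
  then show thesis by (intro that[of "1 + \<bar>Y\<bar> powr b"]) (auto simp: add_pos_nonneg)
qed

text \<open>
  In terms of \<open>y = |\<xi>|\<^sup>\<sigma>\<close> the multiplier is \<open>y\<^bsup>a/\<sigma>\<^esup> e\<^bsup>-cy\<^esup>\<close>.
\<close>

lemma radial_multiplier_bounded:
  assumes \<sigma>: "\<sigma> \<noteq> 0" and a: "a / \<sigma> \<ge> 0" and c: "c > 0"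
  obtains M where "M > 0" "\<And>\<xi> :: 'a::euclidean_space. radial_multiplier a c \<sigma> \<xi> \<le> M"
proof -
  obtain M where M: "M > 0" "\<And>y. y \<ge> 0 \<Longrightarrow> y powr (a / \<sigma>) * exp (- c * y) \<le> M"
    using powr_exp_bounded[OF a c] by metis
  have "radial_multiplier a c \<sigma> \<xi> \<le> M" for \<xi> :: 'a
    using M(2)[of "norm \<xi> powr \<sigma>"] \<sigma> by (simp add: radial_multiplier_def powr_powr)
  then show thesis using M(1) that by blast
qed

text \<open>
  The multiplier is bounded near the origin in both cases, by the exponential if \<open>\<sigma> < 0\<close>. At infinity the exponential
  provides any power of decay if \<open>\<sigma> > 0\<close>, whereas for \<open>\<sigma> < 0\<close> the decay is that of \<open>|\<xi>|\<^sup>a\<close>.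
\<close>

lemma nn_integral_radial_multiplier_finite:
  assumes c: "c > 0" and a: "\<sigma> > 0 \<and> a \<ge> 0 \<or> \<sigma> < 0 \<and> a < - real DIM('a)"
  shows "(\<integral>\<^sup>+ \<xi>. ennreal (radial_multiplier a c \<sigma> (\<xi> :: 'a::euclidean_space)) \<partial>lborel) < \<infinity>"
proof -
  have "\<exists>b M. b > real DIM('a) \<and> M > 0 \<and>
      (\<forall>\<xi> :: 'a. norm \<xi> \<le> 1 \<longrightarrow> radial_multiplier a c \<sigma> \<xi> \<le> M) \<and>
      (\<forall>\<xi> :: 'a. norm \<xi> > 1 \<longrightarrow> radial_multiplier a c \<sigma> \<xi> \<le> M * norm \<xi> powr (- b))"
  proof (cases "\<sigma> > 0")
    case True
    with a have a: "a \<ge> 0" by auto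
    \<comment> \<open>Any exponent above the dimension would do.\<close>
    define b where "b = real DIM('a) + 1"
    obtain M where M: "M > 0" "\<And>\<xi> :: 'a. radial_multiplier a c \<sigma> \<xi> \<le> M"
      using radial_multiplier_bounded[of \<sigma> a c] True a c by auto
    obtain M' where M': "M' > 0" "\<And>\<xi> :: 'a. radial_multiplier (a + b) c \<sigma> \<xi> \<le> M'"
      using radial_multiplier_bounded[of \<sigma> "a + b" c] True a c by (auto simp: b_def)
    have "radial_multiplier a c \<sigma> \<xi> \<le> max M M' * norm \<xi> powr (- b)" if "norm \<xi> > 1" for \<xi> :: 'a
    proof -
      have "radial_multiplier a c \<sigma> \<xi> = radial_multiplier (a + b) c \<sigma> \<xi> * norm \<xi> powr (- b)"
        using that by (simp add: radial_multiplier_def powr_add powr_minus field_simps)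
      also have "\<dots> \<le> max M M' * norm \<xi> powr (- b)"
        using M'(2)[of \<xi>] by (intro mult_right_mono) auto
      finally show ?thesis .
    qed
    moreover have "radial_multiplier a c \<sigma> \<xi> \<le> max M M'" for \<xi> :: 'a
      using M(2)[of \<xi>] by simp
    moreover have "max M M' > 0" using M(1) by simp
    ultimately show ?thesis by (intro exI[of _ b] exI[of _ "max M M'"]) (auto simp: b_def)
  next
    case False
    with a have \<sigma>: "\<sigma> < 0" and a: "a < - real DIM('a)" by auto
    obtain M where M: "M > 0" "\<And>\<xi> :: 'a. radial_multiplier a c \<sigma> \<xi> \<le> M"
      using radial_multiplier_bounded[of \<sigma> a c] \<sigma> a c
      by (metis divide_nonpos_nonpos less_eq_real_def neg_le_0_iff_le not_less_iff_gr_or_eq of_nat_0_le_iff order_trans)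
    have "radial_multiplier a c \<sigma> \<xi> \<le> max M 1 * norm \<xi> powr (- (- a))" if "norm \<xi> > 1" for \<xi> :: 'a
    proof -
      have "radial_multiplier a c \<sigma> \<xi> \<le> norm \<xi> powr a * 1"
        unfolding radial_multiplier_def using c by (intro mult_left_mono) auto
      also have "\<dots> \<le> max M 1 * norm \<xi> powr a"
        using mult_right_mono[of 1 "max M 1" "norm \<xi> powr a"] by simp
      finally show ?thesis by simp
    qed
    moreover have "radial_multiplier a c \<sigma> \<xi> \<le> max M 1" for \<xi> :: 'a
      using M(2)[of \<xi>] by simp
    ultimately show ?thesis using a by (intro exI[of _ "- a"] exI[of _ "max M 1"]) auto
  qed
  then obtain b M where b: "b > real DIM('a)" and M: "M > 0"
    and small: "\<And>\<xi> :: 'a. norm \<xi> \<le> 1 \<Longrightarrow> radial_multiplier a c \<sigma> \<xi> \<le> M"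
    and large: "\<And>\<xi> :: 'a. norm \<xi> > 1 \<Longrightarrow> radial_multiplier a c \<sigma> \<xi> \<le> M * norm \<xi> powr (- b)"
    by blast
  have b0: "b > 0" using b by (meson le_less_trans of_nat_0_le_iff)
  have dom: "radial_multiplier a c \<sigma> \<xi> \<le> M * 2 powr b * (1 + norm \<xi>) powr (- b)" for \<xi> :: 'a
  proof -
    define t where "t = max 1 (norm \<xi>)"
    have "radial_multiplier a c \<sigma> \<xi> \<le> M * t powr (- b)"
      using small[of \<xi>] large[of \<xi>] by (cases "norm \<xi> \<le> 1") (auto simp: t_def max_def)
    also have "\<dots> \<le> M * ((1 + norm \<xi>) / 2) powr (- b)"
    proof (intro mult_left_mono powr_mono2')
      show "0 < (1 + norm \<xi>) / 2" using norm_ge_zero[of \<xi>] by argo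
      show "(1 + norm \<xi>) / 2 \<le> t" by (auto simp: t_def max_def)
    qed (use M b0 in auto)
    also have "((1 + norm \<xi>) / 2) powr (- b) = 2 powr b * (1 + norm \<xi>) powr (- b)"
      by (simp add: powr_divide powr_minus field_simps)
    finally show ?thesis by (simp add: mult.assoc)
  qed
  have "(\<integral>\<^sup>+ \<xi>. ennreal (radial_multiplier a c \<sigma> (\<xi> :: 'a)) \<partial>lborel)
     \<le> (\<integral>\<^sup>+ \<xi>. ennreal (M * 2 powr b) * ennreal ((1 + norm (\<xi> :: 'a)) powr (- b)) \<partial>lborel)"
  proof (intro nn_integral_mono)
    fix \<xi> :: 'a
    have "ennreal (radial_multiplier a c \<sigma> \<xi>) \<le> ennreal (M * 2 powr b * (1 + norm \<xi>) powr (- b))"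
      by (intro ennreal_leI dom)
    then show "ennreal (radial_multiplier a c \<sigma> \<xi>) \<le> ennreal (M * 2 powr b) * ennreal ((1 + norm \<xi>) powr (- b))"
      using M by (simp add: ennreal_mult)
  qed
  also have "\<dots> = ennreal (M * 2 powr b) * (\<integral>\<^sup>+ \<xi>. ennreal ((1 + norm (\<xi> :: 'a)) powr (- b)) \<partial>lborel)"
    by (intro nn_integral_cmult) measurable
  also have "\<dots> < \<infinity>"
    using nn_integral_decay_finite[where 'a='a, OF b] by (simp add: ennreal_mult_less_top)
  finally show ?thesis .
qed

text \<open>
  The power \<open>1/\<theta>\<close> of a radial multiplier is again one, with \<open>a\<close> and \<open>c\<close> divided by \<open>\<theta>\<close>.
\<close>

lemma Lrec_radial_multiplier_finite:
  assumes c: "c > 0" and \<sigma>: "\<sigma> \<noteq> 0" and a: "a / \<sigma> \<ge> 0" and \<theta>: "\<theta> \<ge> 0"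
    and dec: "\<sigma> > 0 \<or> \<theta> = 0 \<or> a < - real DIM('a) * \<theta>"
  obtains A where "A > 0" "Lrec \<theta> (radial_multiplier a c \<sigma> :: 'a::euclidean_space \<Rightarrow> real) \<le> ennreal A"
proof (cases "\<theta> = 0")
  case True
  obtain M where M: "M > 0" "\<And>\<xi> :: 'a. radial_multiplier a c \<sigma> \<xi> \<le> M"
    using radial_multiplier_bounded[OF \<sigma> a c] by metis
  have "AE \<xi> in lborel. norm (radial_multiplier a c \<sigma> (\<xi> :: 'a)) \<le> M"
    using M(2) by (simp add: radial_multiplier_nonneg)
  then have "Lrec 0 (radial_multiplier a c \<sigma> :: 'a \<Rightarrow> real) \<le> ennreal M"
    using M(1) by (subst Lrec_0_le_iff) auto
  then show ?thesis using True M(1) that by blast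
next
  case False
  with \<theta> have \<theta>: "\<theta> > 0" by simp
  have pw: "norm (radial_multiplier a c \<sigma> \<xi>) powr (1 / \<theta>) = radial_multiplier (a / \<theta>) (c / \<theta>) \<sigma> \<xi>" for \<xi> :: 'a
    by (simp add: radial_multiplier_def powr_mult powr_powr exp_powr_real)
  have "\<sigma> > 0 \<and> a / \<theta> \<ge> 0 \<or> \<sigma> < 0 \<and> a / \<theta> < - real DIM('a)"
    using \<theta> \<sigma> a dec by (auto simp: zero_le_divide_iff divide_less_eq mult.commute)
  then have fin: "(\<integral>\<^sup>+ \<xi>. ennreal (norm (radial_multiplier a c \<sigma> (\<xi> :: 'a)) powr (1 / \<theta>)) \<partial>lborel) < \<infinity>"
    unfolding pw using \<theta> c by (intro nn_integral_radial_multiplier_finite) auto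
  then obtain I where I: "I \<ge> 0"
    "(\<integral>\<^sup>+ \<xi>. ennreal (norm (radial_multiplier a c \<sigma> (\<xi> :: 'a)) powr (1 / \<theta>)) \<partial>lborel) = ennreal I"
    by (auto simp: less_top_ennreal)
  define A where "A = (I + 1) powr \<theta>"
  have A: "A > 0" using I by (simp add: A_def)
  have "I \<le> A powr (1 / \<theta>)" using I \<theta> by (simp add: A_def powr_powr)
  then have "Lrec \<theta> (radial_multiplier a c \<sigma> :: 'a \<Rightarrow> real) \<le> ennreal A"
    using \<theta> A I by (subst Lrec_pos_le_iff) (auto intro: ennreal_leI)
  then show ?thesis using A that by blast
qed

text \<open>
  With \<open>s = \<tau>\<^bsup>1/\<sigma>\<^esup>\<close> the multiplier at time \<open>\<tau>\<close> is \<open>\<tau>\<^bsup>-a/\<sigma>\<^esup>\<close> times the dilation by \<open>s\<close> of the one at time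
  \<open>1\<close>, and dilation by \<open>s\<close> multiplies the norm by \<open>s\<^bsup>-n\<theta>\<^esup>\<close>.
\<close>

lemma Lrec_radial_multiplier_time_decay:
  assumes c: "c > 0" and \<sigma>: "\<sigma> \<noteq> 0" and a: "a / \<sigma> \<ge> 0" and \<theta>: "\<theta> \<ge> 0"
    and dec: "\<sigma> > 0 \<or> \<theta> = 0 \<or> a < - real DIM('a) * \<theta>"
  obtains A where "A > 0" "\<And>\<tau>. \<tau> > 0 \<Longrightarrow>
    Lrec \<theta> (radial_multiplier a (c * \<tau>) \<sigma> :: 'a::euclidean_space \<Rightarrow> real)
      \<le> ennreal (A * \<tau> powr (- a / \<sigma> - real DIM('a) / \<sigma> * \<theta>))"
proof -
  obtain A where A: "A > 0" "Lrec \<theta> (radial_multiplier a c \<sigma> :: 'a \<Rightarrow> real) \<le> ennreal A"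
    using Lrec_radial_multiplier_finite[where 'a='a, OF c \<sigma> a \<theta> dec] by metis
  have "Lrec \<theta> (radial_multiplier a (c * \<tau>) \<sigma> :: 'a \<Rightarrow> real)
      \<le> ennreal (A * \<tau> powr (- a / \<sigma> - real DIM('a) / \<sigma> * \<theta>))" if \<tau>: "\<tau> > 0" for \<tau>
  proof -
    define s where "s = \<tau> powr (1 / \<sigma>)"
    have s: "s > 0" using \<tau> by (simp add: s_def)
    have eq: "radial_multiplier a (c * \<tau>) \<sigma> \<xi> = \<tau> powr (- a / \<sigma>) * radial_multiplier a c \<sigma> (s *\<^sub>R \<xi>)" for \<xi> :: 'a
    proof -
      have "norm (s *\<^sub>R \<xi>) powr \<sigma> = \<tau> * norm \<xi> powr \<sigma>"
        using s \<tau> \<sigma> by (simp add: powr_mult) (simp add: s_def powr_powr)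
      moreover have "norm (s *\<^sub>R \<xi>) powr a = \<tau> powr (a / \<sigma>) * norm \<xi> powr a"
        using s \<tau> \<sigma> by (simp add: powr_mult) (simp add: s_def powr_powr)
      moreover have "\<tau> powr (- a / \<sigma>) * \<tau> powr (a / \<sigma>) = 1"
        using \<tau> by (simp add: powr_add[symmetric])
      ultimately show ?thesis by (simp add: radial_multiplier_def mult_ac)
    qed
    have "Lrec \<theta> (radial_multiplier a (c * \<tau>) \<sigma> :: 'a \<Rightarrow> real)
       \<le> ennreal (\<tau> powr (- a / \<sigma>)) * Lrec \<theta> (\<lambda>\<xi> :: 'a. radial_multiplier a c \<sigma> (s *\<^sub>R \<xi>))"
      using \<tau> \<theta> by (intro Lrec_mono) (auto simp: eq radial_multiplier_nonneg abs_mult)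
    also have "\<dots> \<le> ennreal (\<tau> powr (- a / \<sigma>)) * ennreal (s powr (- real DIM('a) * \<theta>) * A)"
      using s \<theta> A by (intro mult_left_mono Lrec_dilate) auto
    also have "\<dots> = ennreal (\<tau> powr (- a / \<sigma>) * (s powr (- real DIM('a) * \<theta>) * A))"
      using A by (simp add: ennreal_mult)
    also have "\<tau> powr (- a / \<sigma>) * (s powr (- real DIM('a) * \<theta>) * A)
        = A * \<tau> powr (- a / \<sigma> - real DIM('a) / \<sigma> * \<theta>)"
    proof -
      have "s powr (- real DIM('a) * \<theta>) = \<tau> powr (- (real DIM('a) / \<sigma> * \<theta>))"
        by (simp add: s_def powr_powr)
      then have "\<tau> powr (- a / \<sigma>) * s powr (- real DIM('a) * \<theta>) = \<tau> powr (- a / \<sigma> - real DIM('a) / \<sigma> * \<theta>)"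
        by (simp only: powr_add[symmetric] diff_conv_add_uminus)
      then show ?thesis by (simp add: mult_ac)
    qed
    finally show ?thesis .
  qed
  then show thesis using A(1) that by blast
qed

section \<open>The decay estimate\<close>

lemma annulus_lower_bound:
  fixes \<eta> :: "'a::euclidean_space \<Rightarrow> real"
  assumes cont: "continuous_on UNIV \<eta>" and pos: "\<And>\<xi>. \<xi> \<noteq> 0 \<Longrightarrow> \<eta> \<xi> > 0" and a: "a > 0"
  obtains m where "m > 0" "\<And>\<xi>. a \<le> norm \<xi> \<Longrightarrow> norm \<xi> \<le> b \<Longrightarrow> m \<le> \<eta> \<xi>"
proof -
  define K where "K = cball (0::'a) b - ball 0 a"
  have K: "\<xi> \<in> K \<longleftrightarrow> a \<le> norm \<xi> \<and> norm \<xi> \<le> b" for \<xi> by (auto simp: K_def)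
  show thesis
  proof (cases "K = {}")
    case True
    then show thesis using K by (intro that[of 1]) auto
  next
    case False
    have "compact K" unfolding K_def by (intro compact_diff) auto
    then obtain z where z: "z \<in> K" "\<And>\<xi>. \<xi> \<in> K \<Longrightarrow> \<eta> z \<le> \<eta> \<xi>"
      using continuous_attains_inf[of K \<eta>] False cont continuous_on_subset by blast
    have "z \<noteq> 0" using z(1) a by (auto simp: K)
    then show thesis using z(2) pos by (intro that[of "\<eta> z"]) (auto simp: K)
  qed
qed

text \<open>
  The asymptotic bounds hold near \<open>0\<close> and near \<open>\<infinity>\<close>. On the compact annuli between these neighbourhoods and the unit
  sphere \<open>\<eta>\<close> has a positive minimum, and the power of \<open>|\<xi>|\<close> in question is at most one there.
\<close>

lemma symbol_lower_bounds:
  fixes \<eta> :: "'a::euclidean_space \<Rightarrow> real"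
  assumes \<sigma>: "\<sigma>\<^sub>1 > 0" "\<sigma>\<^sub>2 > 0"
    and cont: "continuous_on UNIV \<eta>" and pos: "\<And>\<xi>. \<xi> \<noteq> 0 \<Longrightarrow> \<eta> \<xi> > 0"
    and zero: "\<eta> \<in> \<Omega>[at 0](\<lambda>\<xi>. norm \<xi> powr \<sigma>\<^sub>1)"
    and infinity: "\<eta> \<in> \<Omega>[at_infinity](\<lambda>\<xi>. norm \<xi> powr (- \<sigma>\<^sub>2))"
  shows "\<exists>c>0. (\<forall>\<xi>. \<xi> \<noteq> 0 \<longrightarrow> norm \<xi> \<le> 1 \<longrightarrow> c * norm \<xi> powr \<sigma>\<^sub>1 \<le> \<eta> \<xi>) \<and>
    (\<forall>\<xi>. norm \<xi> > 1 \<longrightarrow> c * norm \<xi> powr (- \<sigma>\<^sub>2) \<le> \<eta> \<xi>)"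
proof -
  obtain c1 where c1: "c1 > 0" "eventually (\<lambda>\<xi>. norm (\<eta> \<xi>) \<ge> c1 * norm (norm \<xi> powr \<sigma>\<^sub>1)) (at 0)"
    using zero by (auto elim!: landau_omega.bigE)
  then obtain d where d: "d > 0" "\<And>\<xi>. \<xi> \<noteq> 0 \<Longrightarrow> norm \<xi> < d \<Longrightarrow> norm (\<eta> \<xi>) \<ge> c1 * norm (norm \<xi> powr \<sigma>\<^sub>1)"
    unfolding eventually_at by auto
  obtain c2 where c2: "c2 > 0" "eventually (\<lambda>\<xi>. norm (\<eta> \<xi>) \<ge> c2 * norm (norm \<xi> powr (- \<sigma>\<^sub>2))) at_infinity"
    using infinity by (auto elim!: landau_omega.bigE)
  then obtain b where b: "\<And>\<xi>. norm \<xi> \<ge> b \<Longrightarrow> norm (\<eta> \<xi>) \<ge> c2 * norm (norm \<xi> powr (- \<sigma>\<^sub>2))"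
    unfolding eventually_at_infinity by auto
  obtain m1 where m1: "m1 > 0" "\<And>\<xi>. d \<le> norm \<xi> \<Longrightarrow> norm \<xi> \<le> 1 \<Longrightarrow> m1 \<le> \<eta> \<xi>"
    using annulus_lower_bound[OF cont pos d(1)] by metis
  obtain m2 where m2: "m2 > 0" "\<And>\<xi>. 1 \<le> norm \<xi> \<Longrightarrow> norm \<xi> \<le> b \<Longrightarrow> m2 \<le> \<eta> \<xi>"
    using annulus_lower_bound[OF cont pos, of 1] by auto
  define c where "c = min (min c1 c2) (min m1 m2)"
  have c: "c > 0" "c \<le> c1" "c \<le> c2" "c \<le> m1" "c \<le> m2" using c1 c2 m1 m2 by (auto simp: c_def)
  show ?thesis
  proof (intro exI[of _ c] conjI allI impI c(1))
    fix \<xi> :: 'a assume \<xi>: "\<xi> \<noteq> 0" "norm \<xi> \<le> 1"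
    show "c * norm \<xi> powr \<sigma>\<^sub>1 \<le> \<eta> \<xi>"
    proof (cases "norm \<xi> < d")
      case True
      have "c * norm \<xi> powr \<sigma>\<^sub>1 \<le> c1 * norm \<xi> powr \<sigma>\<^sub>1" using c by (intro mult_right_mono) auto
      also have "\<dots> \<le> \<eta> \<xi>" using d(2)[OF \<xi>(1) True] pos[OF \<xi>(1)] by simp
      finally show ?thesis .
    next
      case False
      have "c * norm \<xi> powr \<sigma>\<^sub>1 \<le> c * 1"
        using c \<xi> \<sigma> powr_mono2[of \<sigma>\<^sub>1 "norm \<xi>" 1] by (intro mult_left_mono) auto
      also have "\<dots> \<le> \<eta> \<xi>" using m1(2)[of \<xi>] False \<xi> c by simp
      finally show ?thesis .
    qed
  next
    fix \<xi> :: 'a assume \<xi>: "norm \<xi> > 1"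
    then have \<xi>0: "\<xi> \<noteq> 0" by auto
    show "c * norm \<xi> powr (- \<sigma>\<^sub>2) \<le> \<eta> \<xi>"
    proof (cases "norm \<xi> \<ge> b")
      case True
      have "c * norm \<xi> powr (- \<sigma>\<^sub>2) \<le> c2 * norm \<xi> powr (- \<sigma>\<^sub>2)" using c by (intro mult_right_mono) auto
      also have "\<dots> \<le> \<eta> \<xi>" using b[OF True] pos[OF \<xi>0] by simp
      finally show ?thesis .
    next
      case False
      have "c * norm \<xi> powr (- \<sigma>\<^sub>2) \<le> c * 1"
        using c \<xi> \<sigma> powr_mono2'[of "- \<sigma>\<^sub>2" 1 "norm \<xi>"] by (intro mult_left_mono) auto
      also have "\<dots> \<le> \<eta> \<xi>" using m2(2)[of \<xi>] False \<xi> c by simp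
      finally show ?thesis .
    qed
  qed
qed

text \<open>
  Replacing \<open>t\<close> by \<open>1 + t\<close> costs the factor \<open>e\<^bsup>cw\<^esup> \<le> e\<^sup>c\<close>. This makes the scaling uniform down to
  \<open>t = 0\<close>.
\<close>

lemma exp_symbol_le:
  fixes w c e t :: real
  assumes "c * w \<le> e" "0 \<le> w" "w \<le> 1" "c > 0" "t \<ge> 0"
  shows "exp (- e * t) \<le> exp c * exp (- (c * (1 + t)) * w)"
proof -
  have "c * w * t \<le> e * t" using assms by (intro mult_right_mono) auto
  moreover have "c * w \<le> c" using assms by simp
  ultimately have "- e * t \<le> c + - (c * (1 + t)) * w" by (simp add: algebra_simps)
  then show ?thesis by (simp add: exp_add[symmetric])
qed

text \<open>
  The common form of the low and high frequency bounds: Hoelder's inequality with reciprocal exponents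
  \<open>1 - P = (Q - P) + (1 - Q)\<close>, the first factor being the radial multiplier and the second the transform weighted by
  \<open>|\<xi>|\<^sup>m\<close>.
\<close>

lemma frequency_region_estimate:
  fixes \<eta> :: "real ^ 'n::finite \<Rightarrow> real" and S :: "(real ^ 'n) set"
  assumes [measurable]: "\<eta> \<in> borel_measurable borel" "S \<in> sets borel"
    and Q: "1 / 2 \<le> Q" "Q \<le> 1" and P: "P \<le> 1 / 2"
    and c: "c > 0" and \<sigma>: "\<sigma> \<noteq> 0" and a: "a / \<sigma> \<ge> 0"
    and dec: "\<sigma> > 0 \<or> Q - P = 0 \<or> a < - real CARD('n) * (Q - P)"
    and k: "real k = a + real m"
    and lower: "\<And>\<xi>. \<xi> \<in> S \<Longrightarrow> \<xi> \<noteq> 0 \<Longrightarrow> c * norm \<xi> powr \<sigma> \<le> \<eta> \<xi>"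
    and small: "\<And>\<xi>. \<xi> \<in> S \<Longrightarrow> \<xi> \<noteq> 0 \<Longrightarrow> norm \<xi> powr \<sigma> \<le> 1"
  obtains C where "C > 0" "\<And>\<phi> t. \<phi> \<in> schwartz \<Longrightarrow> t \<ge> 0 \<Longrightarrow>
     Lrec (1 - P) (\<lambda>\<xi>. indicator S \<xi> * (norm \<xi> ^ k * exp (- \<eta> \<xi> * t) * norm (fourier \<phi> \<xi>)))
       \<le> ennreal (C * (1 + t) powr (- a / \<sigma> - real CARD('n) / \<sigma> * (Q - P))) * Lrec Q (derivs_length m \<phi>)"
proof -
  obtain A where A: "A > 0" "\<And>\<tau>. \<tau> > 0 \<Longrightarrow> Lrec (Q - P) (radial_multiplier a (c * \<tau>) \<sigma> :: real ^ 'n \<Rightarrow> real)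
      \<le> ennreal (A * \<tau> powr (- a / \<sigma> - real CARD('n) / \<sigma> * (Q - P)))"
    using Lrec_radial_multiplier_time_decay[where 'a="real ^ 'n", of c \<sigma> a "Q - P"] c \<sigma> a P Q dec by auto
  obtain D where D: "D > 0" "\<And>\<phi> :: real ^ 'n \<Rightarrow> complex. \<phi> \<in> schwartz \<Longrightarrow>
      Lrec (1 - Q) (\<lambda>\<xi>. norm \<xi> ^ m * norm (fourier \<phi> \<xi>)) \<le> ennreal D * Lrec Q (derivs_length m \<phi>)"
    using hausdorff_young_derivatives[OF Q] by metis
  define C where "C = exp c * A * D"
  have C: "C > 0" using A D by (simp add: C_def)
  have "Lrec (1 - P) (\<lambda>\<xi>. indicator S \<xi> * (norm \<xi> ^ k * exp (- \<eta> \<xi> * t) * norm (fourier \<phi> \<xi>)))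
       \<le> ennreal (C * (1 + t) powr (- a / \<sigma> - real CARD('n) / \<sigma> * (Q - P))) * Lrec Q (derivs_length m \<phi>)"
    if \<phi>: "\<phi> \<in> schwartz" and t: "t \<ge> 0" for \<phi> :: "real ^ 'n \<Rightarrow> complex" and t
  proof -
    note [measurable] = schwartz_borel[OF \<phi>]
    define T where "T = A * (1 + t) powr (- a / \<sigma> - real CARD('n) / \<sigma> * (Q - P))"
    have T: "T > 0" using A t by (simp add: T_def)
    let ?w = "radial_multiplier a (c * (1 + t)) \<sigma> :: real ^ 'n \<Rightarrow> real"
    have "Lrec (Q - P) (\<lambda>\<xi>. exp c * ?w \<xi>) \<le> ennreal (exp c) * Lrec (Q - P) ?w"
      using P Q by (intro Lrec_mono) (auto simp: abs_mult)
    also have "\<dots> \<le> ennreal (exp c) * ennreal T"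
      using A(2)[of "1 + t"] t by (intro mult_left_mono) (auto simp: T_def)
    finally have w: "Lrec (Q - P) (\<lambda>\<xi>. exp c * ?w \<xi>) \<le> ennreal (exp c * T)"
      using T by (simp add: ennreal_mult)
    have "Lrec ((Q - P) + (1 - Q)) (\<lambda>\<xi>. indicator S \<xi> * (norm \<xi> ^ k * exp (- \<eta> \<xi> * t) * norm (fourier \<phi> \<xi>)))
      \<le> ennreal (exp c * T) * Lrec (1 - Q) (\<lambda>\<xi>. norm \<xi> ^ m * norm (fourier \<phi> \<xi>))"
    proof (rule Lrec_Hoelder[OF _ _ _ _ _ _ w])
      have "AE \<xi> in lborel. \<xi> \<noteq> (0 :: real ^ 'n)" by (rule AE_lborel_singleton)
      then show "AE \<xi> in lborel. norm (indicator S \<xi> * (norm \<xi> ^ k * exp (- \<eta> \<xi> * t) * norm (fourier \<phi> \<xi>)))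
        \<le> norm (exp c * ?w \<xi>) * norm (norm \<xi> ^ m * norm (fourier \<phi> \<xi>))"
      proof eventually_elim
        case (elim \<xi>)
        show ?case
        proof (cases "\<xi> \<in> S")
          case True
          have "norm \<xi> ^ k = norm \<xi> powr a * norm \<xi> ^ m"
            using elim by (simp add: powr_realpow[symmetric] powr_add[symmetric] k)
          moreover have "exp (- \<eta> \<xi> * t) \<le> exp c * exp (- (c * (1 + t)) * norm \<xi> powr \<sigma>)"
            using lower[OF True elim] small[OF True elim] c t by (intro exp_symbol_le) auto
          ultimately have "norm \<xi> ^ k * exp (- \<eta> \<xi> * t) \<le> (norm \<xi> powr a * norm \<xi> ^ m) *
              (exp c * exp (- (c * (1 + t)) * norm \<xi> powr \<sigma>))"
            by (simp add: mult_left_mono)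
          then have "norm \<xi> ^ k * exp (- \<eta> \<xi> * t) * norm (fourier \<phi> \<xi>) \<le> (norm \<xi> powr a * norm \<xi> ^ m) *
              (exp c * exp (- (c * (1 + t)) * norm \<xi> powr \<sigma>)) * norm (fourier \<phi> \<xi>)"
            by (intro mult_right_mono) auto
          then show ?thesis
            using True by (simp add: radial_multiplier_def abs_mult mult_ac)
        qed simp
      qed
    qed (use P Q T in auto)
    also have "\<dots> \<le> ennreal (exp c * T) * (ennreal D * Lrec Q (derivs_length m \<phi>))"
      by (intro mult_left_mono D \<phi>) auto
    also have "\<dots> = ennreal (exp c * T * D) * Lrec Q (derivs_length m \<phi>)"
      using T D by (simp add: ennreal_mult mult.assoc)
    also have "exp c * T * D = C * (1 + t) powr (- a / \<sigma> - real CARD('n) / \<sigma> * (Q - P))"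
      by (simp add: C_def T_def mult_ac)
    finally show ?thesis by simp
  qed
  then show thesis using C that by blast
qed

lemma Lp_norm_cong_norm:
  assumes "\<And>x. norm (f x) = norm (g x)" shows "Lp_norm p f = Lp_norm p g"
  using assms by (simp add: Lp_norm_def)

text \<open>
  For real-valued functions the forward and inverse transforms are complex conjugates of each other.
\<close>

lemma norm_inv_fourier_real:
  "norm (inv_fourier (\<lambda>\<xi>. complex_of_real (u \<xi>)) x) = norm (fourier (\<lambda>\<xi>. complex_of_real (u \<xi>)) x)"
proof -
  have "inv_fourier (\<lambda>\<xi>. complex_of_real (u \<xi>)) x
      = (LINT \<xi>|lborel. cnj (complex_of_real (u \<xi>) * cis (- (2 * pi * (\<xi> \<bullet> x)))))"
    unfolding inv_fourier_def by (simp add: cis_cnj inner_commute)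
  also have "\<dots> = cnj (fourier (\<lambda>\<xi>. complex_of_real (u \<xi>)) x)"
    unfolding fourier_def by (rule Bochner_Integration.integral_cnj)
  finally show ?thesis by simp
qed

text \<open>
  If \<open>u\<close> is not integrable, the defining integral of the inverse transform takes the default value \<open>0\<close>, and the left-hand
  side vanishes.
\<close>

lemma hausdorff_young_inverse:
  assumes P: "0 \<le> P" "P \<le> 1 / 2"
  obtains C where "C > 0" "\<And>u :: real ^ 'n::finite \<Rightarrow> real.
     Lrec P (inv_fourier (\<lambda>\<xi>. complex_of_real (u \<xi>))) \<le> ennreal C * Lrec (1 - P) u"
proof -
  have "1 / 2 \<le> 1 - P" "1 - P \<le> 1" using P by auto
  then obtain C where C: "C > 0" "\<And>f :: real ^ 'n \<Rightarrow> complex. integrable lborel f \<Longrightarrow>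
      Lrec (1 - (1 - P)) (fourier f) \<le> ennreal C * Lrec (1 - P) f"
    using hausdorff_young by metis
  have "Lrec P (inv_fourier (\<lambda>\<xi>. complex_of_real (u \<xi>))) \<le> ennreal C * Lrec (1 - P) u" for u :: "real ^ 'n \<Rightarrow> real"
  proof -
    define f where "f \<xi> = complex_of_real (u \<xi>)" for \<xi>
    have inv: "Lrec P (inv_fourier f) = Lrec P (fourier f)"
      unfolding f_def[abs_def] by (intro Lp_norm_cong_norm norm_inv_fourier_real)
    have u: "Lrec (1 - P) u = Lrec (1 - P) f"
      by (intro Lp_norm_cong_norm) (simp add: f_def)
    show ?thesis
    proof (cases "integrable lborel f")
      case True
      then show ?thesis using C(2)[OF True] inv u by (simp add: f_def[abs_def])
    next
      case False
      have "fourier f \<xi> = 0" for \<xi>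
      proof -
        have "\<not> integrable lborel (\<lambda>x. f x * cis (- (2 * pi * (x \<bullet> \<xi>))))"
        proof
          assume "integrable lborel (\<lambda>x. f x * cis (- (2 * pi * (x \<bullet> \<xi>))))"
          then have "integrable lborel (\<lambda>x. f x * cis (- (2 * pi * (x \<bullet> \<xi>))) * cis (2 * pi * (x \<bullet> \<xi>)))"
            by (rule integrable_mult_cis) measurable
          then show False using False by (simp add: mult.assoc cis_mult)
        qed
        then show ?thesis unfolding fourier_def by (rule not_integrable_integral_eq)
      qed
      then have "Lrec P (fourier f) = Lrec P (\<lambda>\<xi>::real ^ 'n. 0 :: complex)"
        by (intro Lp_norm_cong_norm) simp
      also have "\<dots> \<le> ennreal 0"
        using P Lrec_0_le_iff[of "\<lambda>\<xi>::real ^ 'n. 0 :: complex" 0] Lrec_pos_le_iff[of P 0 "\<lambda>\<xi>::real ^ 'n. 0 :: complex"]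
        by (cases "P = 0") auto
      finally show ?thesis using inv by (simp add: f_def[abs_def])
    qed
  qed
  then show thesis using C(1) that by blast
qed

lemma reciprocal_exponent:
  fixes p :: ennreal
  assumes "1 \<le> p"
  shows "inverse (ennreal (enn2real (1 / p))) = p"
    and "2 \<le> p \<Longrightarrow> enn2real (1 / p) \<le> 1 / 2"
    and "p \<le> 2 \<Longrightarrow> 1 / 2 \<le> enn2real (1 / p)"
    and "enn2real (1 / p) \<le> 1"
proof -
  have "inverse (ennreal (enn2real (1 / p))) = p \<and> (2 \<le> p \<longrightarrow> enn2real (1 / p) \<le> 1 / 2)
      \<and> (p \<le> 2 \<longrightarrow> 1 / 2 \<le> enn2real (1 / p)) \<and> enn2real (1 / p) \<le> 1"
  proof (cases p)
    case (real r)
    have r: "r \<ge> 1" using assms real by simp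
    then have "1 / p = ennreal (1 / r)"
      using real divide_ennreal[of 1 r] by simp
    moreover have "inverse (ennreal (1 / r)) = ennreal r"
      using r by (simp add: inverse_ennreal)
    moreover have "2 \<le> p \<longleftrightarrow> 2 \<le> r" "p \<le> 2 \<longleftrightarrow> r \<le> 2"
      using real r by (simp_all flip: ennreal_numeral)
    ultimately show ?thesis using r real by (simp add: field_simps)
  qed (simp_all add: top_unique)
  then show "inverse (ennreal (enn2real (1 / p))) = p"
    and "2 \<le> p \<Longrightarrow> enn2real (1 / p) \<le> 1 / 2"
    and "p \<le> 2 \<Longrightarrow> 1 / 2 \<le> enn2real (1 / p)"
    and "enn2real (1 / p) \<le> 1" by auto
qed

theorem theorem1p1:
  fixes \<eta> :: "real ^ 'n::finite \<Rightarrow> real"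
    and \<sigma>\<^sub>1 \<sigma>\<^sub>2 :: real
    and p q r :: ennreal
    and j k l :: nat
  assumes "\<sigma>\<^sub>1 > 0" and "\<sigma>\<^sub>2 > 0"
    and "continuous_on UNIV \<eta>"
    and "\<And>\<xi>. \<xi> \<noteq> 0 \<Longrightarrow> \<eta> \<xi> > 0"
    and "\<eta> \<in> \<Theta>[at 0](\<lambda>\<xi>. norm \<xi> powr \<sigma>\<^sub>1)"
    and "\<eta> \<in> \<Theta>[at_infinity](\<lambda>\<xi>. norm \<xi> powr (- \<sigma>\<^sub>2))"
    and "1 \<le> q" and "q \<le> 2"
    and "1 \<le> r" and "r \<le> 2"
    and "2 \<le> p"
    and "j \<le> k"
    and "real l > real CARD('n) * (enn2real (1 / r) - enn2real (1 / p)) \<or> (p = 2 \<and> r = 2)"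
  shows "\<exists>C>0. \<forall>\<phi>\<in>(schwartz :: (real ^ 'n \<Rightarrow> complex) set). \<forall>t\<ge>0.
    Lp_norm p (inv_fourier
        (\<lambda>\<xi>. complex_of_real (norm \<xi> ^ k * exp (- \<eta> \<xi> * t) * norm (fourier \<phi> \<xi>))))
    \<le> ennreal (C * (1 + t) powr (- gamma_exponent CARD('n) \<sigma>\<^sub>1 q p - (real k - real j) / \<sigma>\<^sub>1))
          * Lp_norm q (derivs_length j \<phi>)
      + ennreal (C * (1 + t) powr (- real l / \<sigma>\<^sub>2 + gamma_exponent CARD('n) \<sigma>\<^sub>2 r p))
          * Lp_norm r (derivs_length (k + l) \<phi>)"
proof -
  define P where "P = enn2real (1 / p)"
  define Q where "Q = enn2real (1 / q)"
  define R where "R = enn2real (1 / r)"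
  have p1: "1 \<le> p" using \<open>2 \<le> p\<close> by (rule order_trans[rotated]) simp
  have P: "0 \<le> P" "P \<le> 1 / 2" and Q: "1 / 2 \<le> Q" "Q \<le> 1" and R: "1 / 2 \<le> R" "R \<le> 1"
    using reciprocal_exponent[OF p1] reciprocal_exponent[OF \<open>1 \<le> q\<close>] reciprocal_exponent[OF \<open>1 \<le> r\<close>] assms
    by (auto simp: P_def Q_def R_def)
  have pqr: "inverse (ennreal P) = p" "inverse (ennreal Q) = q" "inverse (ennreal R) = r"
    using reciprocal_exponent(1)[OF p1] reciprocal_exponent(1)[OF \<open>1 \<le> q\<close>] reciprocal_exponent(1)[OF \<open>1 \<le> r\<close>]
    by (simp_all add: P_def Q_def R_def)
  have [measurable]: "\<eta> \<in> borel_measurable borel"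
    using assms(3) by (rule borel_measurable_continuous_onI)
  have "\<exists>c>0. (\<forall>\<xi>. \<xi> \<noteq> 0 \<longrightarrow> norm \<xi> \<le> 1 \<longrightarrow> c * norm \<xi> powr \<sigma>\<^sub>1 \<le> \<eta> \<xi>) \<and>
    (\<forall>\<xi>. norm \<xi> > 1 \<longrightarrow> c * norm \<xi> powr (- \<sigma>\<^sub>2) \<le> \<eta> \<xi>)"
    by (rule symbol_lower_bounds) (use assms in \<open>auto dest: bigthetaD2\<close>)
  then obtain c where c: "c > 0"
    "\<And>\<xi>. \<xi> \<noteq> 0 \<Longrightarrow> norm \<xi> \<le> 1 \<Longrightarrow> c * norm \<xi> powr \<sigma>\<^sub>1 \<le> \<eta> \<xi>"
    "\<And>\<xi>. norm \<xi> > 1 \<Longrightarrow> c * norm \<xi> powr (- \<sigma>\<^sub>2) \<le> \<eta> \<xi>"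
    by blast
  define lo hi :: "(real ^ 'n) set" where "lo = cball 0 1" and "hi = - cball 0 1"
  define F where "F \<phi> t \<xi> = norm \<xi> ^ k * exp (- \<eta> \<xi> * t) * norm (fourier \<phi> \<xi>)" for \<phi> t \<xi>
  define E1 where "E1 = - (real k - real j) / \<sigma>\<^sub>1 - real CARD('n) / \<sigma>\<^sub>1 * (Q - P)"
  define E2 where "E2 = - (- real l) / (- \<sigma>\<^sub>2) - real CARD('n) / (- \<sigma>\<^sub>2) * (R - P)"
  obtain C1 where C1: "C1 > 0" "\<And>\<phi> t. \<phi> \<in> schwartz \<Longrightarrow> t \<ge> 0 \<Longrightarrow>
     Lrec (1 - P) (\<lambda>\<xi>. indicator lo \<xi> * F \<phi> t \<xi>)
       \<le> ennreal (C1 * (1 + t) powr E1) * Lrec Q (derivs_length j \<phi>)"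
  proof (rule frequency_region_estimate[of \<eta> lo Q P c \<sigma>\<^sub>1 "real k - real j" k j])
    show "norm \<xi> powr \<sigma>\<^sub>1 \<le> 1" if "\<xi> \<in> lo" for \<xi>
      using that \<open>\<sigma>\<^sub>1 > 0\<close> powr_mono2[of \<sigma>\<^sub>1 "norm \<xi>" 1] by (simp add: lo_def)
  qed (use assms c P Q in \<open>auto simp: lo_def F_def E1_def\<close>)
  obtain C2 where C2: "C2 > 0" "\<And>\<phi> t. \<phi> \<in> schwartz \<Longrightarrow> t \<ge> 0 \<Longrightarrow>
     Lrec (1 - P) (\<lambda>\<xi>. indicator hi \<xi> * F \<phi> t \<xi>)
       \<le> ennreal (C2 * (1 + t) powr E2) * Lrec R (derivs_length (k + l) \<phi>)"
  proof (rule frequency_region_estimate[of \<eta> hi R P c "- \<sigma>\<^sub>2" "- real l" k "k + l"])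
    show "norm \<xi> powr - \<sigma>\<^sub>2 \<le> 1" if "\<xi> \<in> hi" for \<xi>
      using that \<open>\<sigma>\<^sub>2 > 0\<close> powr_mono2'[of "- \<sigma>\<^sub>2" 1 "norm \<xi>"] by (simp add: hi_def)
    show "- \<sigma>\<^sub>2 > 0 \<or> R - P = 0 \<or> - real l < - real CARD('n) * (R - P)"
      using assms(13) by (auto simp: P_def R_def)
  qed (use assms c P R in \<open>auto simp: hi_def F_def E2_def\<close>)
  obtain C0 where C0: "C0 > 0" "\<And>u :: real ^ 'n \<Rightarrow> real.
     Lrec P (inv_fourier (\<lambda>\<xi>. complex_of_real (u \<xi>))) \<le> ennreal C0 * Lrec (1 - P) u"
    using hausdorff_young_inverse[OF P] by metis
  define C where "C = C0 * (C1 + C2)"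
  have C: "C > 0" "C0 * C1 \<le> C" "C0 * C2 \<le> C" using C0 C1 C2 by (auto simp: C_def)
  have main: "Lrec P (inv_fourier (\<lambda>\<xi>. complex_of_real (F \<phi> t \<xi>)))
    \<le> ennreal (C * (1 + t) powr E1) * Lrec Q (derivs_length j \<phi>)
      + ennreal (C * (1 + t) powr E2) * Lrec R (derivs_length (k + l) \<phi>)"
    if \<phi>: "\<phi> \<in> schwartz" and t: "t \<ge> 0" for \<phi> :: "real ^ 'n \<Rightarrow> complex" and t
  proof -
    note [measurable] = schwartz_borel[OF \<phi>]
    have F[measurable]: "F \<phi> t \<in> borel_measurable borel" unfolding F_def[abs_def] by measurable
    have [measurable]: "lo \<in> sets borel" "hi \<in> sets borel" by (auto simp: lo_def hi_def)
    have "Lrec (1 - P) (F \<phi> t) \<le> (\<Sum>S\<in>{lo, hi}. Lrec (1 - P) (\<lambda>\<xi>. indicator S \<xi> * F \<phi> t \<xi>))"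
    proof (rule Lrec_le_sum_of_cover)
      show "AE \<xi> in lborel. \<exists>S\<in>{lo, hi}. norm (F \<phi> t \<xi>) \<le> norm (indicator S \<xi> * F \<phi> t \<xi>)"
        by (intro AE_I2) (auto simp: lo_def hi_def indicator_def)
    qed (use P in auto)
    also have "\<dots> = Lrec (1 - P) (\<lambda>\<xi>. indicator lo \<xi> * F \<phi> t \<xi>) + Lrec (1 - P) (\<lambda>\<xi>. indicator hi \<xi> * F \<phi> t \<xi>)"
    proof -
      have "0 \<in> lo" "0 \<notin> hi" by (auto simp: lo_def hi_def)
      then have "lo \<noteq> hi" by auto
      then show ?thesis by simp
    qed
    also have "\<dots> \<le> ennreal (C1 * (1 + t) powr E1) * Lrec Q (derivs_length j \<phi>)
       + ennreal (C2 * (1 + t) powr E2) * Lrec R (derivs_length (k + l) \<phi>)"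
      by (intro add_mono C1 C2 \<phi> t)
    finally have "ennreal C0 * Lrec (1 - P) (F \<phi> t) \<le> ennreal C0 *
       (ennreal (C1 * (1 + t) powr E1) * Lrec Q (derivs_length j \<phi>)
       + ennreal (C2 * (1 + t) powr E2) * Lrec R (derivs_length (k + l) \<phi>))"
      by (intro mult_left_mono) auto
    also have "\<dots> = ennreal (C0 * C1 * (1 + t) powr E1) * Lrec Q (derivs_length j \<phi>)
       + ennreal (C0 * C2 * (1 + t) powr E2) * Lrec R (derivs_length (k + l) \<phi>)"
      using C0 C1 C2 by (simp add: distrib_left ennreal_mult mult.assoc)
    also have "\<dots> \<le> ennreal (C * (1 + t) powr E1) * Lrec Q (derivs_length j \<phi>)
      + ennreal (C * (1 + t) powr E2) * Lrec R (derivs_length (k + l) \<phi>)"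
      using C by (intro add_mono mult_right_mono ennreal_leI) auto
    finally show ?thesis by (rule order_trans[OF C0(2)])
  qed
  have E1: "E1 = - gamma_exponent CARD('n) \<sigma>\<^sub>1 q p - (real k - real j) / \<sigma>\<^sub>1"
    by (simp add: E1_def gamma_exponent_def P_def Q_def diff_divide_distrib)
  have E2: "E2 = - real l / \<sigma>\<^sub>2 + gamma_exponent CARD('n) \<sigma>\<^sub>2 r p"
    by (simp add: E2_def gamma_exponent_def P_def R_def)
  show ?thesis
  proof (intro exI[of _ C] conjI ballI allI impI C(1))
    fix \<phi> :: "real ^ 'n \<Rightarrow> complex" and t :: real assume "\<phi> \<in> schwartz" "t \<ge> 0"
    from main[OF this, unfolded pqr F_def E1 E2]
    show "Lp_norm p (inv_fourier
        (\<lambda>\<xi>. complex_of_real (norm \<xi> ^ k * exp (- \<eta> \<xi> * t) * norm (fourier \<phi> \<xi>))))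
    \<le> ennreal (C * (1 + t) powr (- gamma_exponent CARD('n) \<sigma>\<^sub>1 q p - (real k - real j) / \<sigma>\<^sub>1))
          * Lp_norm q (derivs_length j \<phi>)
      + ennreal (C * (1 + t) powr (- real l / \<sigma>\<^sub>2 + gamma_exponent CARD('n) \<sigma>\<^sub>2 r p))
          * Lp_norm r (derivs_length (k + l) \<phi>)" .
  qed
qed

end
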